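(* Let $s\in I(\Phi)$, $\sigma\in\mathrm{Inv}^\tau_s(\mathfrak g_{\mathbb R},\mathfrak h_{\mathbb R})$, and let $M$ be a maximal set of pairwise strongly orthogonal roots contained in $\Phi^\sigma_\circledast$ which, among such maximal sets, contains the largest number of long roots. Then there exists $\sigma'\in\mathrm{Inv}^\tau(\mathfrak g_{\mathbb R},\mathfrak h_{\mathbb R})$ such that $\mathfrak g_{\sigma'}\cong\mathfrak g_\sigma$, $\Phi^{\sigma'}_\bullet=\Phi^s_\bullet\cap M^\perp$ and $\Phi^{\sigma'}_\circledast=\emptyset$ (where $M^\perp$ is the set of roots orthogonal to all elements of $M$).
   Context: $\mathfrak g$ is a complex semisimple Lie algebra, $\mathfrak h$ a Cartan subalgebra, $\Phi=\Phi(\mathfrak g,\mathfrak h)$, $\mathfrak h_{\mathbb R}=\{H\in\mathfrak h:\alpha(H)\in\mathbb R\ \forall\alpha\}$; the Killing form gives an inner product on $V=\mathfrak h_{\mathbb R}^*$ in which $\Phi$ is a root system; $I(\Phi)$ is the set of orthogonal involutions of $V$ preserving $\Phi$; for $s\in I(\Phi)$, $\Phi^s_\bullet=\{\alpha:s\alpha=-\alpha\}$. Distinct roots are strongly orthogonal if they are orthogonal and neither their sum nor difference is a root. Fix a Chevalley system $\{(X_\alpha,H_\alpha)\}$: $X_\alpha\in\mathfrak g^\alpha$, $H_\alpha\in\mathfrak h_{\mathbb R}$, $\alpha(H_\beta)\in\mathbb Z$, $[X_\alpha,X_{-\alpha}]=-H_\alpha$, $[H_\alpha,X_{\pm\alpha}]=\pm2X_{\pm\alpha}$,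 with $\mathfrak g_{\mathbb R}=\mathfrak h_{\mathbb R}\oplus\bigoplus_\alpha\mathbb RX_\alpha$ a split real form and $\tau$ ($\tau|_{\mathfrak h_{\mathbb R}}=-\mathrm{id}$, $\tau X_\alpha=X_{-\alpha}$) an involutive automorphism of $\mathfrak g_{\mathbb R}$; $\mathfrak g_u=\{X\in\mathfrak g_{\mathbb R}:\tau X=X\}\oplus i\{X\in\mathfrak g_{\mathbb R}:\tau X=-X\}$. Automorphisms of $\mathfrak g_{\mathbb R}$ are extended anti-$\mathbb C$-linearly to $\mathfrak g$. $\mathrm{Inv}^\tau(\mathfrak g_{\mathbb R},\mathfrak h_{\mathbb R})$ is the set of involutive automorphisms $\sigma$ of $\mathfrak g_{\mathbb R}$ with $\sigma(\mathfrak h_{\mathbb R})=\mathfrak h_{\mathbb R}$, $\sigma(\mathfrak g_u)=\mathfrak g_u$; $\rho(\sigma)$ is $\alpha\mapsto\alpha\circ\sigma^{-1}|_{\mathfrak h_{\mathbb R}}$; $\mathrm{Inv}^\tau_s=\{\sigma:\rho(\sigma)=s\}$; $\mathfrak g_\sigma=\{X\in\mathfrak g_{\mathbb R}:\sigma X=X\}\oplus i\{X\in\mathfrak g_{\mathbb R}:\sigma X=-X\}$. For $\sigma\in\mathrm{Inv}^\tau(\mathfrak g_{\mathbb R},\mathfrak h_{\mathbb R})$ with $s=\rho(\sigma)$ and $\alpha\in\Phi^s_\bullet$ one has $\sigma(X_\alpha)=\pm X_{-\alpha}$; $\Phi^\sigma_\bullet$ (compact imaginary roots) is the set of $\alpha\in\Phi^s_\bullet$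 with $\sigma(X_\alpha)=X_{-\alpha}$ and $\Phi^\sigma_\circledast$ (noncompact imaginary roots) the set with $\sigma(X_\alpha)=-X_{-\alpha}$. *)

theory Defs
  imports "HOL-Analysis.Analysis"
begin

text \<open>
  Model.  The split real form g_R is a finite-dimensional real vector space, represented by a
  type 'a of class euclidean_space (only its real vector space structure is used), with a
  Lie bracket br.  The complex Lie algebra g is the complexification g_R (x) C, represented
  by pairs (X, Y) standing for X + i Y.  h_R is a real subspace hR of g_R and h = hR (x) C.
  Elements of V = h_R^* (real linear functionals on h_R) are represented by functions
  'a => real that are linear on hR and vanish outside hR (so equality of functionals is
  equality of functions).
\<close>

definition lie_algebra :: "('a::real_vector \<Rightarrow> 'a \<Rightarrow> 'a) \<Rightarrow> bool" where
  "lie_algebra br \<longleftrightarrow>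
     (\<forall>y. linear (\<lambda>x. br x y)) \<and> (\<forall>x. linear (br x)) \<and>
     (\<forall>x. br x x = 0) \<and>
     (\<forall>x y z. br x (br y z) + br y (br z x) + br z (br x y) = 0)"

definition trace_op :: "('a::euclidean_space \<Rightarrow> 'a) \<Rightarrow> real" where
  "trace_op f = (\<Sum>b\<in>Basis. inner (f b) b)"

text \<open>Killing form of g_R; it is the restriction of the Killing form of g = g_R (x) C.\<close>
definition killing :: "('a::euclidean_space \<Rightarrow> 'a \<Rightarrow> 'a) \<Rightarrow> 'a \<Rightarrow> 'a \<Rightarrow> real" where
  "killing br x y = trace_op (\<lambda>z. br x (br y z))"

text \<open>g semisimple iff its Killing form (equivalently that of the real form g_R) is nondegenerate.\<close>
definition semisimple :: "('a::euclidean_space \<Rightarrow> 'a \<Rightarrow> 'a) \<Rightarrow> bool" where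
  "semisimple br \<longleftrightarrow> (\<forall>x. (\<forall>y. killing br x y = 0) \<longrightarrow> x = 0)"

definition subalgebra :: "('a::real_vector \<Rightarrow> 'a \<Rightarrow> 'a) \<Rightarrow> 'a set \<Rightarrow> bool" where
  "subalgebra br S \<longleftrightarrow> subspace S \<and> (\<forall>x\<in>S. \<forall>y\<in>S. br x y \<in> S)"

text \<open>Nilpotent: some term of the lower central series vanishes (it is spanned by iterated brackets).\<close>
definition nilpotent_subalg :: "('a::real_vector \<Rightarrow> 'a \<Rightarrow> 'a) \<Rightarrow> 'a set \<Rightarrow> bool" where
  "nilpotent_subalg br S \<longleftrightarrow>
     (\<exists>n. \<forall>hs h. set hs \<subseteq> S \<and> length hs = n \<and> h \<in> S \<longrightarrow> foldr br hs h = 0)"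

definition normalizer :: "('a::real_vector \<Rightarrow> 'a \<Rightarrow> 'a) \<Rightarrow> 'a set \<Rightarrow> 'a set" where
  "normalizer br S = {x. \<forall>h\<in>S. br x h \<in> S}"

text \<open>Cartan subalgebra: nilpotent and self-normalizing.  (h = hR (x) C is Cartan in g
  iff hR is Cartan in g_R, since both properties commute with scalar extension.)\<close>
definition cartan_subalgebra :: "('a::real_vector \<Rightarrow> 'a \<Rightarrow> 'a) \<Rightarrow> 'a set \<Rightarrow> bool" where
  "cartan_subalgebra br S \<longleftrightarrow>
     subalgebra br S \<and> nilpotent_subalg br S \<and> normalizer br S = S"

definition lie_aut :: "('a::real_vector \<Rightarrow> 'a \<Rightarrow> 'a) \<Rightarrow> ('a \<Rightarrow> 'a) \<Rightarrow> bool" where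
  "lie_aut br f \<longleftrightarrow> linear f \<and> bij f \<and> (\<forall>x y. f (br x y) = br (f x) (f y))"

definition dualV :: "'a::real_vector set \<Rightarrow> ('a \<Rightarrow> real) set" where
  "dualV hR = {v. (\<forall>x. x \<notin> hR \<longrightarrow> v x = 0) \<and>
                  (\<forall>x\<in>hR. \<forall>y\<in>hR. v (x + y) = v x + v y) \<and>
                  (\<forall>c. \<forall>x\<in>hR. v (c *\<^sub>R x) = c * v x)}"

definition roots :: "('a::real_vector \<Rightarrow> 'a \<Rightarrow> 'a) \<Rightarrow> 'a set \<Rightarrow> ('a \<Rightarrow> real) set" where
  "roots br hR = {\<alpha>\<in>dualV hR. (\<exists>h\<in>hR. \<alpha> h \<noteq> 0) \<and>
                     (\<exists>X. X \<noteq> 0 \<and> (\<forall>h\<in>hR. br h X = \<alpha> h *\<^sub>R X))}"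

definition negf :: "('a \<Rightarrow> real) \<Rightarrow> ('a \<Rightarrow> real)" where
  "negf \<alpha> = (\<lambda>x. - \<alpha> x)"

definition kdual :: "('a::euclidean_space \<Rightarrow> 'a \<Rightarrow> 'a) \<Rightarrow> 'a set \<Rightarrow> ('a \<Rightarrow> real) \<Rightarrow> 'a" where
  "kdual br hR v = (THE t. t \<in> hR \<and> (\<forall>h\<in>hR. killing br t h = v h))"

definition ipV :: "('a::euclidean_space \<Rightarrow> 'a \<Rightarrow> 'a) \<Rightarrow> 'a set \<Rightarrow> ('a \<Rightarrow> real) \<Rightarrow> ('a \<Rightarrow> real) \<Rightarrow> real" where
  "ipV br hR v w = killing br (kdual br hR v) (kdual br hR w)"

definition inv_rootsys ::
  "('a::euclidean_space \<Rightarrow> 'a \<Rightarrow> 'a) \<Rightarrow> 'a set \<Rightarrow> (('a \<Rightarrow> real) \<Rightarrow> ('a \<Rightarrow> real)) set" where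
  "inv_rootsys br hR = {s.
     (\<forall>v\<in>dualV hR. s v \<in> dualV hR) \<and>
     (\<forall>v\<in>dualV hR. \<forall>w\<in>dualV hR. s (\<lambda>x. v x + w x) = (\<lambda>x. s v x + s w x)) \<and>
     (\<forall>c. \<forall>v\<in>dualV hR. s (\<lambda>x. c * v x) = (\<lambda>x. c * s v x)) \<and>
     (\<forall>v\<in>dualV hR. s (s v) = v) \<and>
     (\<forall>v\<in>dualV hR. \<forall>w\<in>dualV hR. ipV br hR (s v) (s w) = ipV br hR v w) \<and>
     s ` roots br hR = roots br hR}"

definition imag_roots :: "('a::euclidean_space \<Rightarrow> 'a \<Rightarrow> 'a) \<Rightarrow> 'a set \<Rightarrow> (('a \<Rightarrow> real) \<Rightarrow> ('a \<Rightarrow> real)) \<Rightarrow> ('a \<Rightarrow> real) set" where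
  "imag_roots br hR s = {\<alpha>\<in>roots br hR. s \<alpha> = negf \<alpha>}"

definition strongly_orth :: "('a::euclidean_space \<Rightarrow> 'a \<Rightarrow> 'a) \<Rightarrow> 'a set \<Rightarrow> ('a \<Rightarrow> real) \<Rightarrow> ('a \<Rightarrow> real) \<Rightarrow> bool" where
  "strongly_orth br hR \<alpha> \<beta> \<longleftrightarrow> \<alpha> \<noteq> \<beta> \<and> ipV br hR \<alpha> \<beta> = 0 \<and>
      (\<lambda>x. \<alpha> x + \<beta> x) \<notin> roots br hR \<and> (\<lambda>x. \<alpha> x - \<beta> x) \<notin> roots br hR"

definition pairwise_so :: "('a::euclidean_space \<Rightarrow> 'a \<Rightarrow> 'a) \<Rightarrow> 'a set \<Rightarrow> ('a \<Rightarrow> real) set \<Rightarrow> bool" where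
  "pairwise_so br hR A \<longleftrightarrow> (\<forall>\<alpha>\<in>A. \<forall>\<beta>\<in>A. \<alpha> \<noteq> \<beta> \<longrightarrow> strongly_orth br hR \<alpha> \<beta>)"

definition same_component :: "('a::euclidean_space \<Rightarrow> 'a \<Rightarrow> 'a) \<Rightarrow> 'a set \<Rightarrow> ('a \<Rightarrow> real) \<Rightarrow> ('a \<Rightarrow> real) \<Rightarrow> bool" where
  "same_component br hR =
     (\<lambda>a b. a \<in> roots br hR \<and> b \<in> roots br hR \<and> ipV br hR a b \<noteq> 0)\<^sup>*\<^sup>*"

definition long_roots :: "('a::euclidean_space \<Rightarrow> 'a \<Rightarrow> 'a) \<Rightarrow> 'a set \<Rightarrow> ('a \<Rightarrow> real) set" where
  "long_roots br hR = {\<alpha>\<in>roots br hR. \<forall>\<beta>. same_component br hR \<alpha> \<beta> \<longrightarrow>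
                          ipV br hR \<beta> \<beta> \<le> ipV br hR \<alpha> \<alpha>}"

definition orth_roots :: "('a::euclidean_space \<Rightarrow> 'a \<Rightarrow> 'a) \<Rightarrow> 'a set \<Rightarrow> ('a \<Rightarrow> real) set \<Rightarrow> ('a \<Rightarrow> real) set" where
  "orth_roots br hR M = {\<alpha>\<in>roots br hR. \<forall>\<beta>\<in>M. ipV br hR \<alpha> \<beta> = 0}"

definition chevalley_setup ::
  "('a::euclidean_space \<Rightarrow> 'a \<Rightarrow> 'a) \<Rightarrow> 'a set \<Rightarrow> (('a \<Rightarrow> real) \<Rightarrow> 'a) \<Rightarrow> (('a \<Rightarrow> real) \<Rightarrow> 'a)
    \<Rightarrow> ('a \<Rightarrow> 'a) \<Rightarrow> bool" where
  "chevalley_setup br hR X H \<tau> \<longleftrightarrow>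
     lie_algebra br \<and> semisimple br \<and> cartan_subalgebra br hR \<and>
     (\<forall>\<alpha>\<in>roots br hR.
        (\<forall>h\<in>hR. br h (X \<alpha>) = \<alpha> h *\<^sub>R X \<alpha>) \<and>
        H \<alpha> \<in> hR \<and>
        (\<forall>\<beta>\<in>roots br hR. \<beta> (H \<alpha>) \<in> \<int>) \<and>
        br (X \<alpha>) (X (negf \<alpha>)) = - H \<alpha> \<and>
        br (H \<alpha>) (X \<alpha>) = 2 *\<^sub>R X \<alpha> \<and>
        br (H \<alpha>) (X (negf \<alpha>)) = - (2 *\<^sub>R X (negf \<alpha>))) \<and>
     \<comment> \<open>g_R = h_R (+) (+)_alpha R X_alpha, a direct sum\<close>
     inj_on X (roots br hR) \<and> independent (X ` roots br hR) \<and>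
     hR \<inter> span (X ` roots br hR) = {0} \<and>
     (\<forall>v. \<exists>h\<in>hR. \<exists>w\<in>span (X ` roots br hR). v = h + w) \<and>
     \<comment> \<open>tau\<close>
     lie_aut br \<tau> \<and> (\<forall>x. \<tau> (\<tau> x) = x) \<and>
     (\<forall>h\<in>hR. \<tau> h = - h) \<and> (\<forall>\<alpha>\<in>roots br hR. \<tau> (X \<alpha>) = X (negf \<alpha>))"

text \<open>Complexification g = g_R (x) C as pairs (X, Y) = X + iY, with its bracket.\<close>
definition cbr :: "('a::real_vector \<Rightarrow> 'a \<Rightarrow> 'a) \<Rightarrow> 'a \<times> 'a \<Rightarrow> 'a \<times> 'a \<Rightarrow> 'a \<times> 'a" where
  "cbr br u v = (br (fst u) (fst v) - br (snd u) (snd v), br (fst u) (snd v) + br (snd u) (fst v))"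

definition antilin_ext :: "('a::real_vector \<Rightarrow> 'a) \<Rightarrow> 'a \<times> 'a \<Rightarrow> 'a \<times> 'a" where
  "antilin_ext f u = (f (fst u), - f (snd u))"

text \<open>g_sigma = {X : sigma X = X} (+) i {X : sigma X = -X}  (a real subalgebra of g);
  g_u = g_tau.\<close>
definition gfix :: "('a::real_vector \<Rightarrow> 'a) \<Rightarrow> ('a \<times> 'a) set" where
  "gfix \<sigma> = {u. \<sigma> (fst u) = fst u \<and> \<sigma> (snd u) = - snd u}"

definition real_lie_iso :: "('a::real_vector \<Rightarrow> 'a \<Rightarrow> 'a) \<Rightarrow> ('a \<times> 'a) set \<Rightarrow> ('a \<times> 'a) set \<Rightarrow> bool" where
  "real_lie_iso br A B \<longleftrightarrow> (\<exists>f. bij_betw f A B \<and>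
      (\<forall>u\<in>A. \<forall>v\<in>A. f (u + v) = f u + f v) \<and>
      (\<forall>c. \<forall>u\<in>A. f (c *\<^sub>R u) = c *\<^sub>R f u) \<and>
      (\<forall>u\<in>A. \<forall>v\<in>A. f (cbr br u v) = cbr br (f u) (f v)))"

definition Inv_tau :: "('a::real_vector \<Rightarrow> 'a \<Rightarrow> 'a) \<Rightarrow> 'a set \<Rightarrow> ('a \<Rightarrow> 'a) \<Rightarrow> ('a \<Rightarrow> 'a) set" where
  "Inv_tau br hR \<tau> = {\<sigma>. lie_aut br \<sigma> \<and> (\<forall>x. \<sigma> (\<sigma> x) = x) \<and> \<sigma> ` hR = hR \<and>
                        antilin_ext \<sigma> ` gfix \<tau> = gfix \<tau>}"

definition rho :: "'a set \<Rightarrow> ('a \<Rightarrow> 'a) \<Rightarrow> ('a \<Rightarrow> real) \<Rightarrow> ('a \<Rightarrow> real)" where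
  "rho hR \<sigma> \<alpha> = (\<lambda>x. if x \<in> hR then \<alpha> (inv \<sigma> x) else 0)"

definition compact_imag :: "('a::euclidean_space \<Rightarrow> 'a \<Rightarrow> 'a) \<Rightarrow> 'a set \<Rightarrow> (('a \<Rightarrow> real) \<Rightarrow> 'a)
    \<Rightarrow> ('a \<Rightarrow> 'a) \<Rightarrow> ('a \<Rightarrow> real) set" where
  "compact_imag br hR X \<sigma> = {\<alpha>\<in>imag_roots br hR (rho hR \<sigma>). \<sigma> (X \<alpha>) = X (negf \<alpha>)}"

definition noncompact_imag :: "('a::euclidean_space \<Rightarrow> 'a \<Rightarrow> 'a) \<Rightarrow> 'a set \<Rightarrow> (('a \<Rightarrow> real) \<Rightarrow> 'a)
    \<Rightarrow> ('a \<Rightarrow> 'a) \<Rightarrow> ('a \<Rightarrow> real) set" where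
  "noncompact_imag br hR X \<sigma> = {\<alpha>\<in>imag_roots br hR (rho hR \<sigma>). \<sigma> (X \<alpha>) = - X (negf \<alpha>)}"

end

theory Submission
  imports Defs
begin

text \<open>
  Put \<open>k = \<Sum>\<beta>\<in>M. X\<^sub>\<beta> + X\<^sub>-\<^sub>\<beta>\<close> and \<open>E t = exp (t ad k)\<close>, a one-parameter group of automorphisms of
  \<open>g_R\<close> that commutes with \<open>\<tau>\<close>. Since \<open>\<sigma> k = - k\<close>, the conjugate
  \<open>\<sigma>' = E (pi/4) \<circ> \<sigma> \<circ> E (- pi/4)\<close> equals \<open>E (pi/2) \<circ> \<sigma>\<close>, and \<open>E (pi/2)\<close> acts on \<open>h_R\<close> as the product
  of the reflections in the roots of \<open>M\<close>. Hence \<open>g_\<sigma>'\<close> is isomorphic to \<open>g_\<sigma>\<close> and the imaginary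
  roots of \<open>\<sigma>'\<close> are those of \<open>\<sigma>\<close> orthogonal to \<open>M\<close>.

  Let \<open>\<alpha>\<close> be such a root. \<open>E (pi/2)\<close> multiplies \<open>X\<^sub>\<alpha>\<close> by \<open>-1\<close> for each \<open>\<beta> \<in> M\<close> with \<open>\<alpha> \<plusminus> \<beta>\<close> roots, in
  which case \<open>\<alpha>, \<beta>\<close> are short and \<open>\<alpha> \<plusminus> \<beta>\<close> are long. If \<open>\<alpha>\<close> is compact for \<open>\<sigma>\<close> there is no such \<open>\<beta>\<close>,
  since replacing \<open>\<beta>\<close> by \<open>\<alpha> + \<beta>\<close> and \<open>\<alpha> - \<beta>\<close> would increase the number of long roots of \<open>M\<close>. If \<open>\<alpha>\<close> is
  noncompact for \<open>\<sigma>\<close> there is exactly one. In both cases \<open>\<alpha>\<close> is compact for \<open>\<sigma>'\<close>.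

  The exponential is handled only through the uniqueness of solutions of linear differential
  equations: every identity between flows is checked on derivatives.
\<close>

section \<open>Flows of linear vector fields\<close>

text \<open>For linear \<open>D\<close> this is \<open>exp (t D) x\<close>, written as one real
  power series per coordinate, so that theorems on real power series give convergence and termwise
  differentiation.\<close>

definition lin_flow :: "('a::euclidean_space \<Rightarrow> 'a) \<Rightarrow> real \<Rightarrow> 'a \<Rightarrow> 'a" where
  "lin_flow D t x = (\<Sum>b\<in>Basis. (\<Sum>n. (inner ((D ^^ n) x) b / fact n) * t ^ n) *\<^sub>R b)"

lemma linear_norm_bound:
  fixes D :: "'a::euclidean_space \<Rightarrow> 'a"
  assumes "linear D"
  obtains B where "B > 0" "\<And>x. norm (D x) \<le> B * norm x"
  using linear_bounded_pos[OF assms] by blast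

text \<open>A bound \<open>B\<close> for \<open>D\<close> makes the exponential series of
  \<open>B * \<bar>t\<bar>\<close>, times \<open>norm x\<close>, a majorant.\<close>

lemma flow_coeff_summable:
  fixes D :: "'a::euclidean_space \<Rightarrow> 'a"
  assumes "linear D" and b: "b \<in> Basis"
  shows "summable (\<lambda>n. (inner ((D ^^ n) x) b / fact n) * t ^ n)"
proof -
  obtain B where B: "B > 0" "\<And>x. norm (D x) \<le> B * norm x"
    using linear_norm_bound[OF assms(1)] by blast
  have pw: "norm ((D ^^ n) x) \<le> B ^ n * norm x" for n
  proof (induction n)
    case (Suc n)
    have "norm ((D ^^ Suc n) x) \<le> B * norm ((D ^^ n) x)" using B by simp
    also have "\<dots> \<le> B * (B ^ n * norm x)" using Suc B by (intro mult_left_mono) auto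
    finally show ?case by simp
  qed simp
  have "summable (\<lambda>n. inverse (fact n) * (B * \<bar>t\<bar>) ^ n * norm x)"
    by (intro summable_mult2 summable_exp)
  then show ?thesis
  proof (rule summable_comparison_test')
    fix n
    have "norm ((inner ((D ^^ n) x) b / fact n) * t ^ n) = \<bar>inner ((D ^^ n) x) b\<bar> * inverse (fact n) * \<bar>t\<bar> ^ n"
      by (simp add: abs_mult power_abs field_simps)
    also have "\<dots> \<le> (B ^ n * norm x) * inverse (fact n) * \<bar>t\<bar> ^ n"
      using Basis_le_norm[OF b, of "(D ^^ n) x"] pw[of n] by (intro mult_right_mono) auto
    finally show "norm ((inner ((D ^^ n) x) b / fact n) * t ^ n) \<le> inverse (fact n) * (B * \<bar>t\<bar>) ^ n * norm x"
      by (simp add: power_mult_distrib mult_ac)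
  qed
qed

lemma lin_flow_0 [simp]: "lin_flow D 0 x = x"
proof -
  have "(\<Sum>n. (inner ((D ^^ n) x) b / fact n) * 0 ^ n) = inner x b" for b
    using powser_sums_zero[of "\<lambda>n. inner ((D ^^ n) x) b / fact n"] by (simp add: sums_iff)
  then show ?thesis by (simp add: lin_flow_def euclidean_representation)
qed

lemma lin_flow_deriv:
  fixes D :: "'a::euclidean_space \<Rightarrow> 'a"
  assumes D: "linear D"
  shows "((\<lambda>t. lin_flow D t x) has_vector_derivative D (lin_flow D t x)) (at t)"
proof -
  let ?c = "\<lambda>b n. inner ((D ^^ n) x) b / fact n"
  let ?e = "\<lambda>b t. \<Sum>n. ?c b n * t ^ n"
  have d: "(?e b has_vector_derivative (\<Sum>c\<in>Basis. ?e c t * inner (D c) b)) (at t)"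
    if b: "b \<in> Basis" for b
  proof -
    have "(?e b has_field_derivative (\<Sum>n. diffs (?c b) n * t ^ n)) (at t)"
      by (rule termdiffs_strong_converges_everywhere) (rule flow_coeff_summable[OF D b])
    moreover have "(\<Sum>n. diffs (?c b) n * t ^ n) = (\<Sum>c\<in>Basis. ?e c t * inner (D c) b)"
    proof -
      \<comment> \<open>Differentiation shifts the series by one power of \<open>D\<close>.
        Expanding \<open>(D ^^ n) x\<close> in the basis turns that extra \<open>D\<close> into
        matrix entries.\<close>
      have step: "diffs (?c b) n * t ^ n = (\<Sum>c\<in>Basis. (?c c n * t ^ n) * inner (D c) b)" for n
      proof -
        have "inner ((D ^^ Suc n) x) b = inner (D (\<Sum>c\<in>Basis. inner ((D ^^ n) x) c *\<^sub>R c)) b"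
          by (simp add: euclidean_representation)
        also have "\<dots> = (\<Sum>c\<in>Basis. inner ((D ^^ n) x) c * inner (D c) b)"
          by (simp add: linear_sum[OF D] linear_scale[OF D] inner_sum_left)
        finally have e: "inner ((D ^^ Suc n) x) b = (\<Sum>c\<in>Basis. inner ((D ^^ n) x) c * inner (D c) b)" .
        have "diffs (?c b) n * t ^ n = inner ((D ^^ Suc n) x) b / fact n * t ^ n"
          by (simp add: diffs_def del: funpow.simps of_nat_Suc)
        also have "\<dots> = (\<Sum>c\<in>Basis. (?c c n * t ^ n) * inner (D c) b)"
          unfolding e sum_divide_distrib sum_distrib_right by (intro sum.cong) auto
        finally show ?thesis .
      qed
      have "(\<Sum>n. diffs (?c b) n * t ^ n) = (\<Sum>c\<in>Basis. \<Sum>n. (?c c n * t ^ n) * inner (D c) b)"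
        unfolding step by (intro suminf_sum summable_mult2 flow_coeff_summable D)
      also have "\<dots> = (\<Sum>c\<in>Basis. ?e c t * inner (D c) b)"
        by (intro sum.cong refl suminf_mult2[symmetric] flow_coeff_summable D)
      finally show ?thesis .
    qed
    ultimately show ?thesis by (simp add: has_real_derivative_iff_has_vector_derivative)
  qed
  have "((\<lambda>t. lin_flow D t x) has_vector_derivative
      (\<Sum>b\<in>Basis. (\<Sum>c\<in>Basis. ?e c t * inner (D c) b) *\<^sub>R b)) (at t)"
    unfolding lin_flow_def
    by (intro has_vector_derivative_sum bounded_linear.has_vector_derivative[OF bounded_linear_scaleR_left] d)
  moreover have "(\<Sum>b\<in>Basis. (\<Sum>c\<in>Basis. ?e c t * inner (D c) b) *\<^sub>R b) = D (lin_flow D t x)"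
  proof -
    have "D (lin_flow D t x) = (\<Sum>c\<in>Basis. ?e c t *\<^sub>R D c)"
      by (simp add: lin_flow_def linear_sum[OF D] linear_scale[OF D])
    then have "inner (D (lin_flow D t x)) b = (\<Sum>c\<in>Basis. ?e c t * inner (D c) b)" for b
      by (simp add: inner_sum_left)
    then show ?thesis
      by (metis (no_types, lifting) euclidean_representation sum.cong)
  qed
  ultimately show ?thesis by simp
qed

text \<open>Gronwall argument: \<open>B\<close> bounds the growth rate of \<open>z\<close>, so
  \<open>exp (- 2 * B * t)\<close> times the square norm of \<open>z\<close> is nonincreasing. It
  starts at \<open>0\<close> and cannot be negative.\<close>

lemma linear_ode_zero_nonneg:
  fixes D :: "'a::euclidean_space \<Rightarrow> 'a"
  assumes D: "linear D" and z: "\<And>t. (z has_vector_derivative D (z t)) (at t)" and z0: "z 0 = 0"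
    and t: "t \<ge> 0"
  shows "z t = 0"
proof -
  obtain B where B: "B > 0" "\<And>x. norm (D x) \<le> B * norm x"
    using linear_norm_bound[OF D] by blast
  let ?p = "\<lambda>t. exp (- 2 * B * t) * inner (z t) (z t)"
  have "?p t \<le> ?p 0"
  proof (rule DERIV_nonpos_imp_nonincreasing[OF t])
    fix u
    have "((\<lambda>t. inner (z t) (z t)) has_vector_derivative (inner (z u) (D (z u)) + inner (D (z u)) (z u))) (at u)"
      by (rule bounded_bilinear.has_vector_derivative[OF bounded_bilinear_inner z z])
    then have "((\<lambda>t. inner (z t) (z t)) has_real_derivative (2 * inner (z u) (D (z u)))) (at u)"
      by (simp add: has_real_derivative_iff_has_vector_derivative inner_commute)
    then have "(?p has_real_derivative (exp (- 2 * B * u) * (2 * inner (z u) (D (z u)))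
        + (exp (- 2 * B * u) * (- 2 * B)) * inner (z u) (z u))) (at u)"
      by (auto intro!: derivative_eq_intros)
    moreover have "inner (z u) (D (z u)) \<le> B * inner (z u) (z u)"
    proof -
      have "inner (z u) (D (z u)) \<le> norm (z u) * norm (D (z u))" by (rule norm_cauchy_schwarz)
      also have "\<dots> \<le> norm (z u) * (B * norm (z u))" using B by (intro mult_left_mono) auto
      finally show ?thesis by (simp add: dot_square_norm power2_eq_square mult_ac)
    qed
    then have "exp (- 2 * B * u) * (inner (z u) (D (z u)) - B * inner (z u) (z u)) \<le> 0"
      by (simp add: mult_nonneg_nonpos)
    then have "exp (- 2 * B * u) * (2 * inner (z u) (D (z u)))
        + (exp (- 2 * B * u) * (- 2 * B)) * inner (z u) (z u) \<le> 0"
      by (simp add: algebra_simps)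
    ultimately show "\<exists>y. DERIV ?p u :> y \<and> y \<le> 0" by blast
  qed
  then have "exp (- 2 * B * t) * inner (z t) (z t) \<le> 0" by (simp add: z0)
  then have "inner (z t) (z t) \<le> 0" by (simp add: mult_le_0_iff)
  then show ?thesis by (metis inner_eq_zero_iff inner_ge_zero order_antisym)
qed

text \<open>The difference from the flow solves the same equation and starts at \<open>0\<close>.
  Negative times follow by time reversal, which replaces \<open>D\<close> by
  \<open>- D\<close>.\<close>

lemma linear_ode_unique:
  fixes D :: "'a::euclidean_space \<Rightarrow> 'a"
  assumes D: "linear D" and f: "\<And>t. (f has_vector_derivative D (f t)) (at t)" and f0: "f 0 = x"
  shows "f t = lin_flow D t x"
proof -
  define z where "z t = f t - lin_flow D t x" for t
  have z: "(z has_vector_derivative D (z t)) (at t)" for t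
    unfolding z_def linear_diff[OF D]
    by (intro has_vector_derivative_diff f lin_flow_deriv D)
  have z0: "z 0 = 0" by (simp add: z_def f0)
  have zm: "((\<lambda>t. z (- t)) has_vector_derivative - D (z (- t))) (at t)" for t
  proof -
    have "((z \<circ> uminus) has_vector_derivative (-1) *\<^sub>R D (z (- t))) (at t)"
      by (rule vector_diff_chain_at) (auto intro!: derivative_eq_intros z)
    then show ?thesis by (simp add: o_def)
  qed
  have "z t = 0"
  proof (cases "t \<ge> 0")
    case True
    then show ?thesis using linear_ode_zero_nonneg[OF D z z0] by blast
  next
    case False
    then show ?thesis
      using linear_ode_zero_nonneg[of "\<lambda>x. - D x" "\<lambda>t. z (- t)" "- t"] zm z0 linear_compose_neg[OF D]
      by auto
  qed
  then show ?thesis by (simp add: z_def)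
qed

text \<open>Both sides solve the equation of \<open>D'\<close> with initial value
  \<open>f x\<close>. For \<open>D' = - D\<close> it says that a map anticommuting with the
  generator reverses time.\<close>

lemma lin_flow_intertwine:
  fixes D :: "'a::euclidean_space \<Rightarrow> 'a"
  assumes "linear D" "linear D'" "linear f" and "\<And>x. f (D x) = D' (f x)"
  shows "f (lin_flow D t x) = lin_flow D' t (f x)"
proof (rule linear_ode_unique[OF assms(2)])
  show "((\<lambda>t. f (lin_flow D t x)) has_vector_derivative D' (f (lin_flow D t x))) (at t)" for t
    unfolding assms(4)[symmetric]
    by (rule bounded_linear.has_vector_derivative[OF _ lin_flow_deriv[OF assms(1)]])
      (simp add: assms(3) linear_conv_bounded_linear[symmetric])
qed simp

lemma lin_flow_uminus:
  fixes D :: "'a::euclidean_space \<Rightarrow> 'a"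
  assumes D: "linear D"
  shows "lin_flow (\<lambda>x. - D x) t x = lin_flow D (- t) x"
proof (rule linear_ode_unique[OF linear_compose_neg[OF D], symmetric])
  show "((\<lambda>t. lin_flow D (- t) x) has_vector_derivative - D (lin_flow D (- t) x)) (at t)" for t
  proof -
    have "(((\<lambda>t. lin_flow D t x) \<circ> uminus) has_vector_derivative (-1) *\<^sub>R D (lin_flow D (- t) x)) (at t)"
      by (rule vector_diff_chain_at) (auto intro!: derivative_eq_intros lin_flow_deriv D)
    then show ?thesis by (simp add: o_def)
  qed
qed simp

lemma lin_flow_add:
  fixes D :: "'a::euclidean_space \<Rightarrow> 'a"
  assumes D: "linear D"
  shows "lin_flow D t (lin_flow D u x) = lin_flow D (t + u) x"
proof (rule linear_ode_unique[OF D, symmetric])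
  show "((\<lambda>t. lin_flow D (t + u) x) has_vector_derivative D (lin_flow D (t + u) x)) (at t)" for t
  proof -
    have "(((\<lambda>t. lin_flow D t x) \<circ> (\<lambda>t. t + u)) has_vector_derivative 1 *\<^sub>R D (lin_flow D (t + u) x)) (at t)"
      by (rule vector_diff_chain_at) (auto intro!: derivative_eq_intros lin_flow_deriv D)
    then show ?thesis by (simp add: o_def)
  qed
qed simp

lemma linear_lin_flow:
  fixes D :: "'a::euclidean_space \<Rightarrow> 'a"
  assumes D: "linear D"
  shows "linear (lin_flow D t)"
proof (rule linearI)
  show "lin_flow D t (x + y) = lin_flow D t x + lin_flow D t y" for x y
    by (rule linear_ode_unique[OF D, symmetric])
      (auto simp: linear_add[OF D] intro!: has_vector_derivative_add lin_flow_deriv D)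
  show "lin_flow D t (c *\<^sub>R x) = c *\<^sub>R lin_flow D t x" for c x
    using lin_flow_intertwine[OF D D, of "\<lambda>x. c *\<^sub>R x"] linear_scale[OF D]
    by (simp add: linear_scale_self)
qed

section \<open>Traces\<close>

lemma trace_op_comm:
  fixes f g :: "'a::euclidean_space \<Rightarrow> 'a"
  assumes f: "linear f" and g: "linear g"
  shows "trace_op (\<lambda>x. f (g x)) = trace_op (\<lambda>x. g (f x))"
proof -
  have e: "trace_op (\<lambda>x. f (g x)) = (\<Sum>b\<in>Basis. \<Sum>c\<in>Basis. inner (g b) c * inner (f c) b)"
    if "linear f" "linear g" for f g :: "'a \<Rightarrow> 'a"
  proof -
    have "inner (f (g b)) b = (\<Sum>c\<in>Basis. inner (g b) c * inner (f c) b)" for b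
    proof -
      have "f (g b) = f (\<Sum>c\<in>Basis. inner (g b) c *\<^sub>R c)" by (simp add: euclidean_representation)
      also have "\<dots> = (\<Sum>c\<in>Basis. inner (g b) c *\<^sub>R f c)"
        by (simp add: linear_sum[OF that(1)] linear_scale[OF that(1)])
      finally show ?thesis by (simp add: inner_sum_left)
    qed
    then show ?thesis by (simp add: trace_op_def)
  qed
  have "trace_op (\<lambda>x. f (g x)) = (\<Sum>c\<in>Basis. \<Sum>b\<in>Basis. inner (g b) c * inner (f c) b)"
    unfolding e[OF f g] by (rule sum.swap)
  also have "\<dots> = trace_op (\<lambda>x. g (f x))"
    unfolding e[OF g f] by (simp add: mult.commute)
  finally show ?thesis .
qed

text \<open>Each summand has rank one. Root vectors need not be orthonormal for the inner product
  behind \<open>trace_op\<close>; this computes traces of operators diagonal in them without a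
  change of basis.\<close>

lemma trace_op_rank_one_sum:
  fixes \<phi> :: "'i \<Rightarrow> 'a::euclidean_space \<Rightarrow> real"
  assumes "\<And>i. i \<in> I \<Longrightarrow> linear (\<phi> i)"
  shows "trace_op (\<lambda>x. \<Sum>i\<in>I. \<phi> i x *\<^sub>R v i) = (\<Sum>i\<in>I. \<phi> i (v i))"
proof -
  have "trace_op (\<lambda>x. \<Sum>i\<in>I. \<phi> i x *\<^sub>R v i) = (\<Sum>i\<in>I. \<Sum>b\<in>Basis. inner (v i) b * \<phi> i b)"
    by (simp add: trace_op_def inner_sum_left mult.commute) (rule sum.swap)
  also have "\<dots> = (\<Sum>i\<in>I. \<phi> i (v i))"
  proof (rule sum.cong[OF refl])
    fix i assume "i \<in> I"
    then have l: "linear (\<phi> i)" by (rule assms)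
    have "(\<Sum>b\<in>Basis. inner (v i) b * \<phi> i b) = \<phi> i (\<Sum>b\<in>Basis. inner (v i) b *\<^sub>R b)"
      by (simp add: linear_sum[OF l] linear_scale[OF l])
    then show "(\<Sum>b\<in>Basis. inner (v i) b * \<phi> i b) = \<phi> i (v i)"
      by (simp add: euclidean_representation)
  qed
  finally show ?thesis .
qed

section \<open>Roots of a Chevalley system\<close>

definition addf :: "('a \<Rightarrow> real) \<Rightarrow> ('a \<Rightarrow> real) \<Rightarrow> 'a \<Rightarrow> real" where
  "addf \<alpha> \<beta> = (\<lambda>x. \<alpha> x + \<beta> x)"

lemma addf_apply [simp]: "addf \<alpha> \<beta> x = \<alpha> x + \<beta> x"
  by (simp add: addf_def)

lemma negf_apply [simp]: "negf \<alpha> x = - \<alpha> x"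
  by (simp add: negf_def)

lemma negf_negf [simp]: "negf (negf \<alpha>) = \<alpha>"
  by (simp add: negf_def)

locale chevalley =
  fixes br :: "'a::euclidean_space \<Rightarrow> 'a \<Rightarrow> 'a"
    and hR :: "'a set"
    and X H :: "('a \<Rightarrow> real) \<Rightarrow> 'a"
    and \<tau> :: "'a \<Rightarrow> 'a"
  assumes chev: "chevalley_setup br hR X H \<tau>"
begin

abbreviation \<Phi> :: "('a \<Rightarrow> real) set" where "\<Phi> \<equiv> roots br hR"
abbreviation ip :: "('a \<Rightarrow> real) \<Rightarrow> ('a \<Rightarrow> real) \<Rightarrow> real" where "ip \<equiv> ipV br hR"

section \<open>Bracket and Killing form\<close>

lemma lie: "lie_algebra br"
  using chev by (simp add: chevalley_setup_def)

lemma linear_br_left: "linear (\<lambda>x. br x y)" and linear_br: "linear (br x)"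
  and br_self [simp]: "br x x = 0"
  using lie by (auto simp: lie_algebra_def)

lemmas br_add_left = linear_add[OF linear_br_left]
  and br_add_right = linear_add[OF linear_br]
  and br_diff_left = linear_diff[OF linear_br_left]
  and br_diff_right = linear_diff[OF linear_br]
  and br_scale_left = linear_scale[OF linear_br_left]
  and br_scale_right = linear_scale[OF linear_br]
  and br_neg_left = linear_neg[OF linear_br_left]
  and br_neg_right = linear_neg[OF linear_br]
  and br_sum_left = linear_sum[OF linear_br_left]
  and br_sum_right = linear_sum[OF linear_br]
  and br_0_left = linear_0[OF linear_br_left]
  and br_0_right = linear_0[OF linear_br]

lemmas br_linear = br_add_left br_add_right br_diff_left br_diff_right br_scale_left br_scale_right
  br_neg_left br_neg_right br_0_left br_0_right

lemma br_anti: "br x y = - br y x"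
proof -
  have "br x y + br y x = 0"
    using br_self[of "x + y"] unfolding br_add_left br_add_right by (simp add: add.commute)
  then show ?thesis by (simp add: eq_neg_iff_add_eq_0)
qed

lemma jacobi: "br x (br y z) = br (br x y) z + br y (br x z)"
proof -
  have "br x (br y z) + br y (br z x) + br z (br x y) = 0"
    using lie by (auto simp: lie_algebra_def)
  moreover have "br y (br z x) = - br y (br x z)" "br z (br x y) = - br (br x y) z"
    using br_anti[of z x] br_anti[of z "br x y"] by (simp_all add: br_neg_right)
  ultimately show ?thesis by (simp add: algebra_simps)
qed

lemma killing_add_left: "killing br (x + y) z = killing br x z + killing br y z"
  by (simp add: killing_def trace_op_def br_add_left inner_add_left sum.distrib)

lemma killing_scale_left: "killing br (c *\<^sub>R x) z = c * killing br x z"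
  by (simp add: killing_def trace_op_def br_scale_left sum_distrib_left)

lemma killing_commute: "killing br x y = killing br y x"
  unfolding killing_def by (rule trace_op_comm) (rule linear_br)+

lemma linear_killing: "linear (\<lambda>x. killing br x z)"
  by (rule linearI) (auto simp: killing_add_left killing_scale_left)

lemma linear_killing_right: "linear (killing br z)"
proof -
  have "killing br z = (\<lambda>x. killing br x z)" by (rule ext) (rule killing_commute)
  then show ?thesis using linear_killing by simp
qed

lemmas killing_linear = linear_add[OF linear_killing] linear_add[OF linear_killing_right]
  linear_diff[OF linear_killing] linear_diff[OF linear_killing_right]
  linear_scale[OF linear_killing] linear_scale[OF linear_killing_right]
  linear_neg[OF linear_killing] linear_neg[OF linear_killing_right]
  linear_0[OF linear_killing] linear_0[OF linear_killing_right]

text \<open>Jacobi writes the adjoint operator of a bracket as a commutator, and the trace is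
  cyclic.\<close>

lemma killing_invariant: "killing br (br x y) z = killing br x (br y z)"
proof -
  have "killing br (br x y) z = trace_op (\<lambda>v. br x (br y (br z v)) - br y (br x (br z v)))"
    unfolding killing_def by (subst jacobi) (simp add: algebra_simps)
  also have "\<dots> = trace_op (\<lambda>v. br x (br y (br z v))) - trace_op (\<lambda>v. br y (br x (br z v)))"
    by (simp add: trace_op_def inner_diff_left sum_subtractf)
  also have "trace_op (\<lambda>v. br y (br x (br z v))) = trace_op (\<lambda>v. br x (br z (br y v)))"
    using trace_op_comm[OF linear_br[of y] linear_compose[OF linear_br[of z] linear_br[of x]]]
    by (simp add: o_def)
  also have "trace_op (\<lambda>v. br x (br y (br z v))) - trace_op (\<lambda>v. br x (br z (br y v)))
      = killing br x (br y z)"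
    unfolding killing_def jacobi[of y z]
    by (simp add: trace_op_def inner_diff_left sum_subtractf[symmetric] br_add_right inner_add_left)
  finally show ?thesis .
qed

lemma killing_nondegenerate: "(\<And>y. killing br x y = 0) \<Longrightarrow> x = 0"
  using chev by (auto simp: chevalley_setup_def semisimple_def)

section \<open>Cartan subalgebra and root decomposition\<close>

lemma subspace_hR: "subspace hR"
  using chev by (auto simp: chevalley_setup_def cartan_subalgebra_def subalgebra_def)

lemma br_hR: "h \<in> hR \<Longrightarrow> k \<in> hR \<Longrightarrow> br h k \<in> hR"
  using chev by (auto simp: chevalley_setup_def cartan_subalgebra_def subalgebra_def)

lemma tau_aut: "lie_aut br \<tau>"
  and tau_tau [simp]: "\<tau> (\<tau> x) = x"
  and tau_hR: "h \<in> hR \<Longrightarrow> \<tau> h = - h"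
  and tau_X: "\<alpha> \<in> \<Phi> \<Longrightarrow> \<tau> (X \<alpha>) = X (negf \<alpha>)"
  using chev by (auto simp: chevalley_setup_def)

lemma linear_tau: "linear \<tau>" and tau_br: "\<tau> (br x y) = br (\<tau> x) (\<tau> y)"
  using tau_aut by (auto simp: lie_aut_def)

text \<open>The Chevalley involution is \<open>-1\<close> on \<open>hR\<close>, so it both fixes and negates a bracket in \<open>hR\<close>.\<close>
lemma hR_abelian: assumes "h \<in> hR" "k \<in> hR" shows "br h k = 0"
proof -
  have "- br h k = br h k"
    using tau_hR[OF br_hR[OF assms]] tau_br[of h k] by (simp add: tau_hR assms br_linear)
  then have "2 *\<^sub>R br h k = 0" by (simp add: scaleR_2 neg_eq_iff_add_eq_0)
  then show ?thesis by simp
qed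

lemma finite_roots: "finite \<Phi>"
proof -
  have "independent (X ` \<Phi>)" "inj_on X \<Phi>" using chev by (auto simp: chevalley_setup_def)
  then show ?thesis using independent_bound finite_imageD by blast
qed

lemma X_sum_zero:
  assumes "(\<Sum>\<alpha>\<in>\<Phi>. c \<alpha> *\<^sub>R X \<alpha>) = 0" "\<alpha> \<in> \<Phi>" shows "c \<alpha> = 0"
proof -
  have i: "independent (X ` \<Phi>)" "inj_on X \<Phi>" using chev by (auto simp: chevalley_setup_def)
  have "(\<Sum>v\<in>X ` \<Phi>. c (inv_into \<Phi> X v) *\<^sub>R v) = (\<Sum>\<alpha>\<in>\<Phi>. c \<alpha> *\<^sub>R X \<alpha>)"
    by (simp add: sum.reindex[OF i(2)] inv_into_f_f[OF i(2)])
  with assms have "c (inv_into \<Phi> X (X \<alpha>)) = 0"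
    using independentD[OF i(1) finite_imageI[OF finite_roots] subset_refl,
        of "\<lambda>v. c (inv_into \<Phi> X v)" "X \<alpha>"] by simp
  then show ?thesis using assms(2) i by simp
qed

lemma X_nonzero: "\<alpha> \<in> \<Phi> \<Longrightarrow> X \<alpha> \<noteq> 0"
  using X_sum_zero[of "\<lambda>\<beta>. if \<beta> = \<alpha> then 1 else 0" \<alpha>] finite_roots
  by (auto simp: if_distrib[of "\<lambda>c. c *\<^sub>R _"] sum.delta cong: if_cong)

lemma decompose:
  obtains h c where "h \<in> hR" "v = h + (\<Sum>\<alpha>\<in>\<Phi>. c \<alpha> *\<^sub>R X \<alpha>)"
proof -
  obtain h w where "h \<in> hR" "w \<in> span (X ` \<Phi>)" and v: "v = h + w"
    using chev by (auto simp: chevalley_setup_def) metis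
  moreover then obtain u where "w = (\<Sum>v\<in>X ` \<Phi>. u v *\<^sub>R v)"
    using span_finite[OF finite_imageI[OF finite_roots]] by auto
  moreover have "inj_on X \<Phi>" using chev by (auto simp: chevalley_setup_def)
  ultimately show ?thesis using that[of h "\<lambda>\<alpha>. u (X \<alpha>)"] by (simp add: sum.reindex)
qed

lemma decompose_zero:
  assumes "h \<in> hR" "h + (\<Sum>\<alpha>\<in>\<Phi>. c \<alpha> *\<^sub>R X \<alpha>) = 0"
  shows "h = 0" "\<alpha> \<in> \<Phi> \<Longrightarrow> c \<alpha> = 0"
proof -
  have "h = - (\<Sum>\<alpha>\<in>\<Phi>. c \<alpha> *\<^sub>R X \<alpha>)" using assms(2) by (simp add: eq_neg_iff_add_eq_0)
  also have "\<dots> \<in> span (X ` \<Phi>)"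
    by (intro span_neg span_sum span_scale span_base imageI)
  finally show "h = 0" using assms(1) chev by (auto simp: chevalley_setup_def)
  then show "\<alpha> \<in> \<Phi> \<Longrightarrow> c \<alpha> = 0" using assms(2) X_sum_zero by simp
qed

section \<open>Functionals on \<open>hR\<close> and weight vectors\<close>

lemma root_dual: "\<alpha> \<in> \<Phi> \<Longrightarrow> \<alpha> \<in> dualV hR"
  by (simp add: roots_def)

lemma root_nonzero: "\<alpha> \<in> \<Phi> \<Longrightarrow> \<exists>h\<in>hR. \<alpha> h \<noteq> 0"
  by (simp add: roots_def)

lemma dual_outside: "\<alpha> \<in> dualV hR \<Longrightarrow> x \<notin> hR \<Longrightarrow> \<alpha> x = 0"
  by (simp add: dualV_def)

lemma dual_add: "\<alpha> \<in> dualV hR \<Longrightarrow> x \<in> hR \<Longrightarrow> y \<in> hR \<Longrightarrow> \<alpha> (x + y) = \<alpha> x + \<alpha> y"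
  by (simp add: dualV_def)

lemma dual_scale: "\<alpha> \<in> dualV hR \<Longrightarrow> x \<in> hR \<Longrightarrow> \<alpha> (c *\<^sub>R x) = c * \<alpha> x"
  by (simp add: dualV_def)

lemma dual_neg: "\<alpha> \<in> dualV hR \<Longrightarrow> x \<in> hR \<Longrightarrow> \<alpha> (- x) = - \<alpha> x"
  using dual_scale[of \<alpha> x "-1"] by simp

lemma dual_diff: "\<alpha> \<in> dualV hR \<Longrightarrow> x \<in> hR \<Longrightarrow> y \<in> hR \<Longrightarrow> \<alpha> (x - y) = \<alpha> x - \<alpha> y"
  using dual_add[of \<alpha> x "- y"] dual_neg[of \<alpha> y] subspace_neg[OF subspace_hR] by simp

lemma dual_sum:
  assumes "\<alpha> \<in> dualV hR" "\<And>i. i \<in> I \<Longrightarrow> x i \<in> hR"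
  shows "\<alpha> (\<Sum>i\<in>I. x i) = (\<Sum>i\<in>I. \<alpha> (x i))"
  using assms(2)
proof (induction I rule: infinite_finite_induct)
  case (insert i I)
  then have "x i \<in> hR" "sum x I \<in> hR" using subspace_sum[OF subspace_hR, of I x] by auto
  then show ?case using insert dual_add[OF assms(1)] by simp
qed (use dual_scale[OF assms(1) subspace_0[OF subspace_hR], of 0] in auto)

lemma dual_eqI: "\<alpha> \<in> dualV hR \<Longrightarrow> \<beta> \<in> dualV hR \<Longrightarrow> (\<And>h. h \<in> hR \<Longrightarrow> \<alpha> h = \<beta> h) \<Longrightarrow> \<alpha> = \<beta>"
  by (metis dual_outside ext)

lemma dual_addf: "\<alpha> \<in> dualV hR \<Longrightarrow> \<beta> \<in> dualV hR \<Longrightarrow> addf \<alpha> \<beta> \<in> dualV hR"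
  by (auto simp: dualV_def algebra_simps)

lemma dual_negf: "\<alpha> \<in> dualV hR \<Longrightarrow> negf \<alpha> \<in> dualV hR"
  by (auto simp: dualV_def)

lemma dual_mult: "\<alpha> \<in> dualV hR \<Longrightarrow> (\<lambda>x. c * \<alpha> x) \<in> dualV hR"
  by (auto simp: dualV_def algebra_simps)

text \<open>Zero vectors and functionals that are not roots are allowed, so a bracket of root
  vectors has a weight before it is known whether the sum is a root.\<close>

definition weight :: "'a \<Rightarrow> ('a \<Rightarrow> real) \<Rightarrow> bool" where
  "weight v \<alpha> \<longleftrightarrow> (\<forall>h\<in>hR. br h v = \<alpha> h *\<^sub>R v)"

lemma weight_X: "\<alpha> \<in> \<Phi> \<Longrightarrow> weight (X \<alpha>) \<alpha>"
  using chev by (auto simp: chevalley_setup_def weight_def)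

lemma weight_br: "weight v \<alpha> \<Longrightarrow> weight w \<beta> \<Longrightarrow> weight (br v w) (addf \<alpha> \<beta>)"
  by (simp add: weight_def jacobi[of _ v w] br_linear algebra_simps)

lemma rootI: "\<alpha> \<in> dualV hR \<Longrightarrow> h \<in> hR \<Longrightarrow> \<alpha> h \<noteq> 0 \<Longrightarrow> v \<noteq> 0 \<Longrightarrow> weight v \<alpha> \<Longrightarrow> \<alpha> \<in> \<Phi>"
  by (auto simp: roots_def weight_def)

lemma weight_not_root:
  "\<alpha> \<in> dualV hR \<Longrightarrow> h \<in> hR \<Longrightarrow> \<alpha> h \<noteq> 0 \<Longrightarrow> weight v \<alpha> \<Longrightarrow> \<alpha> \<notin> \<Phi> \<Longrightarrow> v = 0"
  using rootI by blast

text \<open>Comparing coefficients in \<open>br h v = \<alpha> h *\<^sub>R v\<close> along the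
  direct sum kills the part in \<open>hR\<close> and all roots other than \<alpha>, because distinct
  roots differ at some \<open>h\<close>. So root spaces are lines.\<close>

lemma root_space:
  assumes a: "\<alpha> \<in> \<Phi>" and w: "weight v \<alpha>"
  obtains c where "v = c *\<^sub>R X \<alpha>"
proof -
  obtain h0 c where h0: "h0 \<in> hR" and v: "v = h0 + (\<Sum>\<beta>\<in>\<Phi>. c \<beta> *\<^sub>R X \<beta>)"
    by (rule decompose)
  have z: "\<alpha> h *\<^sub>R h0 = 0" "\<beta> \<in> \<Phi> \<Longrightarrow> (\<alpha> h - \<beta> h) * c \<beta> = 0" if h: "h \<in> hR" for h \<beta>
  proof -
    have "br h v = (\<Sum>\<beta>\<in>\<Phi>. (\<beta> h * c \<beta>) *\<^sub>R X \<beta>)"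
      unfolding v br_add_right br_sum_right hR_abelian[OF h h0] using weight_X h
      by (auto simp: weight_def br_linear mult.commute intro!: sum.cong)
    moreover have "br h v = \<alpha> h *\<^sub>R v" using w h by (simp add: weight_def)
    ultimately have eq: "\<alpha> h *\<^sub>R h0 + (\<Sum>\<beta>\<in>\<Phi>. ((\<alpha> h - \<beta> h) * c \<beta>) *\<^sub>R X \<beta>) = 0"
      by (simp add: v algebra_simps scaleR_sum_right sum_subtractf)
    note z = decompose_zero[OF subspace_scale[OF subspace_hR h0] eq]
    show "\<alpha> h *\<^sub>R h0 = 0" by (rule z(1))
    show "\<beta> \<in> \<Phi> \<Longrightarrow> (\<alpha> h - \<beta> h) * c \<beta> = 0" by (rule z(2))
  qed
  have "h0 = 0" using z(1) root_nonzero[OF a] by auto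
  moreover have "c \<beta> = 0" if "\<beta> \<in> \<Phi>" "\<beta> \<noteq> \<alpha>" for \<beta>
    using z(2)[OF _ that(1)] dual_eqI[OF root_dual root_dual] that a by (metis mult_eq_0_iff right_minus_eq)
  then have "(\<Sum>\<beta>\<in>\<Phi>. c \<beta> *\<^sub>R X \<beta>) = (\<Sum>\<beta>\<in>\<Phi>. if \<beta> = \<alpha> then c \<alpha> *\<^sub>R X \<alpha> else 0)"
    by (intro sum.cong) auto
  then have "(\<Sum>\<beta>\<in>\<Phi>. c \<beta> *\<^sub>R X \<beta>) = c \<alpha> *\<^sub>R X \<alpha>"
    using a finite_roots by (simp add: sum.delta)
  ultimately show ?thesis using v that[of "c \<alpha>"] by simp
qed

lemma weight_tau: "weight v \<alpha> \<Longrightarrow> weight (\<tau> v) (negf \<alpha>)"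
  unfolding weight_def
proof
  fix h assume *: "\<forall>h\<in>hR. br h v = \<alpha> h *\<^sub>R v" "h \<in> hR"
  have "br h (\<tau> v) = \<tau> (br (- h) v)" using * by (simp add: tau_br linear_neg[OF linear_tau] tau_hR)
  then show "br h (\<tau> v) = negf \<alpha> h *\<^sub>R \<tau> v"
    using * by (simp add: br_linear linear_neg[OF linear_tau] linear_scale[OF linear_tau])
qed

text \<open>\<tau> is \<open>-1\<close> on \<open>hR\<close>, so it moves a root vector to the
  opposite weight.\<close>

lemma negf_root: assumes "\<alpha> \<in> \<Phi>" shows "negf \<alpha> \<in> \<Phi>"
proof -
  obtain h where "h \<in> hR" "\<alpha> h \<noteq> 0" using root_nonzero[OF assms] by blast
  moreover have "\<tau> (X \<alpha>) \<noteq> 0" using X_nonzero[OF assms] by (metis tau_tau linear_0[OF linear_tau])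
  ultimately show ?thesis
    using weight_tau[OF weight_X[OF assms]] dual_negf[OF root_dual[OF assms]] rootI by auto
qed

lemma H_hR: "\<alpha> \<in> \<Phi> \<Longrightarrow> H \<alpha> \<in> hR"
  and root_H_int: "\<alpha> \<in> \<Phi> \<Longrightarrow> \<beta> \<in> \<Phi> \<Longrightarrow> \<beta> (H \<alpha>) \<in> \<int>"
  and br_X_negX: "\<alpha> \<in> \<Phi> \<Longrightarrow> br (X \<alpha>) (X (negf \<alpha>)) = - H \<alpha>"
  using chev by (auto simp: chevalley_setup_def)

lemma root_H_self: assumes "\<alpha> \<in> \<Phi>" shows "\<alpha> (H \<alpha>) = 2"
proof -
  have "br (H \<alpha>) (X \<alpha>) = 2 *\<^sub>R X \<alpha>" using assms chev by (auto simp: chevalley_setup_def)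
  moreover have "br (H \<alpha>) (X \<alpha>) = \<alpha> (H \<alpha>) *\<^sub>R X \<alpha>"
    using weight_X[OF assms] H_hR[OF assms] by (simp add: weight_def)
  ultimately show ?thesis using X_nonzero[OF assms] by simp
qed

lemma br_hX: "\<alpha> \<in> \<Phi> \<Longrightarrow> h \<in> hR \<Longrightarrow> br h (X \<alpha>) = \<alpha> h *\<^sub>R X \<alpha>"
  using weight_X by (simp add: weight_def)

section \<open>Killing form on root vectors and on \<open>hR\<close>\<close>

lemma killing_weights:
  assumes "weight v \<alpha>" "weight w \<beta>" "h \<in> hR" "\<alpha> h + \<beta> h \<noteq> 0"
  shows "killing br v w = 0"
proof -
  have "killing br (br v h) w = killing br v (br h w)" by (rule killing_invariant)
  moreover have "br v h = - (\<alpha> h *\<^sub>R v)" "br h w = \<beta> h *\<^sub>R w"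
    using assms br_anti[of v h] by (auto simp: weight_def)
  ultimately have "(\<alpha> h + \<beta> h) * killing br v w = 0" by (simp add: killing_linear algebra_simps)
  then show ?thesis using assms(4) by simp
qed

lemma killing_hX: assumes "\<alpha> \<in> \<Phi>" "h \<in> hR" shows "killing br (X \<alpha>) h = 0"
proof -
  have "weight h (\<lambda>_. 0)" using hR_abelian assms(2) by (simp add: weight_def)
  then show ?thesis
    using killing_weights[OF weight_X[OF assms(1)]] root_nonzero[OF assms(1)] by force
qed

lemma killing_XX: assumes "\<alpha> \<in> \<Phi>" "\<beta> \<in> \<Phi>" "\<beta> \<noteq> negf \<alpha>" shows "killing br (X \<alpha>) (X \<beta>) = 0"
proof -
  obtain h where "h \<in> hR" "\<beta> h \<noteq> negf \<alpha> h"
    using dual_eqI[OF root_dual root_dual] assms negf_root by blast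
  then show ?thesis using killing_weights[OF weight_X weight_X] assms by force
qed

text \<open>The minus sign compensates the one in \<open>br_X_negX\<close> and makes the value
  positive. The square length of \<alpha> turns out to be \<open>2 / N \<alpha>\<close>.\<close>

definition N :: "('a \<Rightarrow> real) \<Rightarrow> real" where
  "N \<alpha> = - killing br (X \<alpha>) (X (negf \<alpha>))"

text \<open>In the decomposition only \<open>X (negf \<alpha>)\<close> can pair nontrivially with
  \<open>X \<alpha>\<close>; were that pairing zero, \<open>X \<alpha>\<close> would lie in the
  radical of the Killing form.\<close>

lemma N_nonzero: assumes "\<alpha> \<in> \<Phi>" shows "N \<alpha> \<noteq> 0"
proof
  assume z: "N \<alpha> = 0"
  have "killing br (X \<alpha>) y = 0" for y
  proof -
    obtain h c where "h \<in> hR" and y: "y = h + (\<Sum>\<beta>\<in>\<Phi>. c \<beta> *\<^sub>R X \<beta>)" by (rule decompose)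
    moreover have "killing br (X \<alpha>) (X \<beta>) = 0" if "\<beta> \<in> \<Phi>" for \<beta>
      using killing_XX[OF assms that] z by (auto simp: N_def)
    ultimately show ?thesis
      using killing_hX[OF assms] by (simp add: killing_linear linear_sum[OF linear_killing_right])
  qed
  then show False using killing_nondegenerate X_nonzero[OF assms] by blast
qed

text \<open>For a root \<alpha> this is the coefficient of \<open>X \<alpha>\<close> in the
  decomposition. Expressed through the Killing form it is linear at once, and no coefficients have
  to be chosen.\<close>

definition coord :: "('a \<Rightarrow> real) \<Rightarrow> 'a \<Rightarrow> real" where
  "coord \<alpha> v = killing br v (X (negf \<alpha>)) / - N \<alpha>"

lemma linear_coord: "linear (coord \<alpha>)"
  unfolding coord_def by (rule linearI) (simp_all add: killing_linear add_divide_distrib)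

lemma coord_X: assumes "\<alpha> \<in> \<Phi>" "\<beta> \<in> \<Phi>" shows "coord \<alpha> (X \<beta>) = (if \<alpha> = \<beta> then 1 else 0)"
proof (cases "\<alpha> = \<beta>")
  case True
  then show ?thesis using N_nonzero[OF assms(1)] by (simp add: coord_def N_def)
next
  case False
  then have "negf \<alpha> \<noteq> negf \<beta>" by (metis negf_negf)
  then show ?thesis using killing_XX[OF assms(2) negf_root[OF assms(1)]] False by (simp add: coord_def)
qed

lemma coord_h: assumes "\<alpha> \<in> \<Phi>" "h \<in> hR" shows "coord \<alpha> h = 0"
  using killing_hX[OF negf_root[OF assms(1)] assms(2)] by (simp add: coord_def killing_commute)

text \<open>\<open>br h\<close> and \<open>br k\<close> are diagonal in the root vectors and vanish
  on \<open>hR\<close>, so the trace sums products of eigenvalues.\<close>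

lemma killing_hR:
  assumes "h \<in> hR" "k \<in> hR" shows "killing br h k = (\<Sum>\<alpha>\<in>\<Phi>. \<alpha> h * \<alpha> k)"
proof -
  have "br h (br k v) = (\<Sum>\<alpha>\<in>\<Phi>. (\<alpha> h * \<alpha> k * coord \<alpha> v) *\<^sub>R X \<alpha>)" for v
  proof -
    obtain l c where l: "l \<in> hR" and v: "v = l + (\<Sum>\<beta>\<in>\<Phi>. c \<beta> *\<^sub>R X \<beta>)" by (rule decompose)
    have "coord \<alpha> v = c \<alpha>" if "\<alpha> \<in> \<Phi>" for \<alpha>
      using that l finite_roots
      by (simp add: v linear_add[OF linear_coord] linear_sum[OF linear_coord] linear_scale[OF linear_coord]
          coord_h coord_X if_distrib sum.delta cong: if_cong)
    moreover have "br h (br k v) = (\<Sum>\<alpha>\<in>\<Phi>. (\<alpha> h * \<alpha> k * c \<alpha>) *\<^sub>R X \<alpha>)"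
      using assms l by (simp add: v br_linear br_sum_right hR_abelian br_hX mult_ac cong: sum.cong)
    ultimately show ?thesis by simp
  qed
  then have "killing br h k = trace_op (\<lambda>v. \<Sum>\<alpha>\<in>\<Phi>. (\<alpha> h * \<alpha> k * coord \<alpha> v) *\<^sub>R X \<alpha>)"
    by (simp add: killing_def)
  also have "\<dots> = (\<Sum>\<alpha>\<in>\<Phi>. \<alpha> h * \<alpha> k * coord \<alpha> (X \<alpha>))"
    by (rule trace_op_rank_one_sum)
      (rule linearI, simp_all add: linear_add[OF linear_coord] linear_scale[OF linear_coord] algebra_simps)
  finally show ?thesis by (simp add: coord_X)
qed

lemma killing_hR_nonneg: "h \<in> hR \<Longrightarrow> killing br h h \<ge> 0"
  by (simp add: killing_hR sum_nonneg)

text \<open>A zero sum of squares makes all roots vanish at \<open>h\<close>. Then \<open>h\<close>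
  is central and lies in the radical of the Killing form.\<close>

lemma killing_hR_eq_0: assumes "h \<in> hR" "killing br h h = 0" shows "h = 0"
proof (rule killing_nondegenerate)
  have z: "\<alpha> h = 0" if "\<alpha> \<in> \<Phi>" for \<alpha>
    using assms that finite_roots by (simp add: killing_hR sum_nonneg_eq_0_iff)
  have "br h v = 0" for v
  proof -
    obtain l c where "l \<in> hR" "v = l + (\<Sum>\<beta>\<in>\<Phi>. c \<beta> *\<^sub>R X \<beta>)" by (rule decompose)
    then show ?thesis using assms z by (simp add: br_linear br_sum_right hR_abelian br_hX sum.neutral)
  qed
  then show "killing br h y = 0" for y by (simp add: killing_def trace_op_def)
qed

lemma killing_H: assumes "\<alpha> \<in> \<Phi>" "h \<in> hR" shows "killing br (H \<alpha>) h = N \<alpha> * \<alpha> h"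
proof -
  have "br (X (negf \<alpha>)) h = \<alpha> h *\<^sub>R X (negf \<alpha>)"
    using br_anti[of "X (negf \<alpha>)" h] br_hX[OF negf_root[OF assms(1)] assms(2)] by simp
  moreover have "killing br (br (X \<alpha>) (X (negf \<alpha>))) h = killing br (X \<alpha>) (br (X (negf \<alpha>)) h)"
    by (rule killing_invariant)
  ultimately show ?thesis by (simp add: br_X_negX[OF assms(1)] killing_linear N_def mult.commute)
qed

lemma N_pos: assumes "\<alpha> \<in> \<Phi>" shows "N \<alpha> > 0"
proof -
  have "2 * N \<alpha> = killing br (H \<alpha>) (H \<alpha>)"
    using killing_H[OF assms H_hR[OF assms]] by (simp add: root_H_self assms)
  then show ?thesis using killing_hR_nonneg[OF H_hR[OF assms]] N_nonzero[OF assms] by linarith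
qed

text \<open>By \<open>killing_H\<close> the dual vector is a rescaled coroot, and it is unique
  because the form is definite on \<open>hR\<close>. Inner products of roots thereby become values
  of roots at coroots.\<close>

lemma kdual_root: assumes "\<alpha> \<in> \<Phi>" shows "kdual br hR \<alpha> = (1 / N \<alpha>) *\<^sub>R H \<alpha>"
  unfolding kdual_def
proof (rule the_equality)
  let ?t = "(1 / N \<alpha>) *\<^sub>R H \<alpha>"
  have t: "?t \<in> hR" "\<And>h. h \<in> hR \<Longrightarrow> killing br ?t h = \<alpha> h"
    using subspace_scale[OF subspace_hR H_hR[OF assms]] N_pos[OF assms]
    by (auto simp: killing_linear killing_H assms)
  then show "?t \<in> hR \<and> (\<forall>h\<in>hR. killing br ?t h = \<alpha> h)" by blast
  fix t assume u: "t \<in> hR \<and> (\<forall>h\<in>hR. killing br t h = \<alpha> h)"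
  have "t - ?t \<in> hR" using u t subspace_diff[OF subspace_hR] by blast
  then have "killing br (t - ?t) (t - ?t) = 0" using u t by (simp add: killing_linear(3))
  then show "t = ?t" using killing_hR_eq_0 \<open>t - ?t \<in> hR\<close> by force
qed

section \<open>Inner products and integrality of roots\<close>

lemma ip_root: assumes "\<alpha> \<in> \<Phi>" "\<beta> \<in> \<Phi>" shows "ip \<alpha> \<beta> = \<alpha> (H \<beta>) / N \<beta>"
  using N_pos[OF assms(1)] N_pos[OF assms(2)] assms
  by (simp add: ipV_def kdual_root killing_linear killing_H H_hR)

lemma ip_commute: "ip \<alpha> \<beta> = ip \<beta> \<alpha>"
  by (simp add: ipV_def killing_commute)

lemma ip_self: "\<alpha> \<in> \<Phi> \<Longrightarrow> ip \<alpha> \<alpha> = 2 / N \<alpha>"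
  by (simp add: ip_root root_H_self)

lemma ip_pos: "\<alpha> \<in> \<Phi> \<Longrightarrow> ip \<alpha> \<alpha> > 0"
  using N_pos by (simp add: ip_self)

lemma root_H: assumes "\<alpha> \<in> \<Phi>" "\<beta> \<in> \<Phi>" shows "\<alpha> (H \<beta>) = 2 * ip \<alpha> \<beta> / ip \<beta> \<beta>"
  using N_pos[OF assms(2)] by (simp add: ip_root assms root_H_self)

lemma ip_eq_0_iff: "\<alpha> \<in> \<Phi> \<Longrightarrow> \<beta> \<in> \<Phi> \<Longrightarrow> ip \<alpha> \<beta> = 0 \<longleftrightarrow> \<alpha> (H \<beta>) = 0"
  using N_pos[of \<beta>] by (simp add: ip_root)

lemma ip_addf: "\<alpha> \<in> \<Phi> \<Longrightarrow> \<beta> \<in> \<Phi> \<Longrightarrow> addf \<alpha> \<beta> \<in> \<Phi> \<Longrightarrow> \<gamma> \<in> \<Phi> \<Longrightarrow> ip (addf \<alpha> \<beta>) \<gamma> = ip \<alpha> \<gamma> + ip \<beta> \<gamma>"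
  by (simp add: ip_root add_divide_distrib)

lemma ip_negf: "\<alpha> \<in> \<Phi> \<Longrightarrow> \<beta> \<in> \<Phi> \<Longrightarrow> ip (negf \<alpha>) \<beta> = - ip \<alpha> \<beta>"
  by (simp add: ip_root negf_root)

lemma ip_negf_right: "\<alpha> \<in> \<Phi> \<Longrightarrow> \<beta> \<in> \<Phi> \<Longrightarrow> ip \<alpha> (negf \<beta>) = - ip \<alpha> \<beta>"
  by (metis ip_commute ip_negf)

text \<open>The expression is the square norm of \<open>p \<alpha> - q \<beta>\<close>.\<close>
lemma ip_square_expand:
  assumes "\<alpha> \<in> \<Phi>" "\<beta> \<in> \<Phi>"
  shows "0 \<le> p\<^sup>2 * ip \<alpha> \<alpha> - 2 * p * q * ip \<alpha> \<beta> + q\<^sup>2 * ip \<beta> \<beta>"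
    and "p\<^sup>2 * ip \<alpha> \<alpha> - 2 * p * q * ip \<alpha> \<beta> + q\<^sup>2 * ip \<beta> \<beta> = 0 \<Longrightarrow> h \<in> hR \<Longrightarrow> p * \<alpha> h = q * \<beta> h"
proof -
  let ?a = "kdual br hR \<alpha>" and ?b = "kdual br hR \<beta>"
  let ?v = "p *\<^sub>R ?a - q *\<^sub>R ?b"
  have ab: "?a \<in> hR" "?b \<in> hR" using assms H_hR subspace_scale[OF subspace_hR] by (auto simp: kdual_root)
  then have v: "?v \<in> hR" using subspace_scale[OF subspace_hR] subspace_diff[OF subspace_hR] by blast
  have e: "killing br ?v ?v = p\<^sup>2 * ip \<alpha> \<alpha> - 2 * p * q * ip \<alpha> \<beta> + q\<^sup>2 * ip \<beta> \<beta>"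
    by (simp add: ipV_def killing_linear killing_commute[of ?b ?a] power2_eq_square algebra_simps)
  show "0 \<le> p\<^sup>2 * ip \<alpha> \<alpha> - 2 * p * q * ip \<alpha> \<beta> + q\<^sup>2 * ip \<beta> \<beta>"
    using killing_hR_nonneg[OF v] e by simp
  assume "p\<^sup>2 * ip \<alpha> \<alpha> - 2 * p * q * ip \<alpha> \<beta> + q\<^sup>2 * ip \<beta> \<beta> = 0" and h: "h \<in> hR"
  then have "?v = 0" using killing_hR_eq_0[OF v] e by simp
  then have "killing br ?v h = 0" by (simp add: killing_linear)
  moreover have "killing br ?a h = \<alpha> h" "killing br ?b h = \<beta> h"
    using assms h N_pos[of \<alpha>] N_pos[of \<beta>] by (auto simp: kdual_root killing_linear killing_H)
  ultimately show "p * \<alpha> h = q * \<beta> h" by (simp add: killing_linear)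
qed

lemma ip_cauchy_schwarz: assumes "\<alpha> \<in> \<Phi>" "\<beta> \<in> \<Phi>" shows "(ip \<alpha> \<beta>)\<^sup>2 \<le> ip \<alpha> \<alpha> * ip \<beta> \<beta>"
proof -
  \<comment> \<open>The choice \<open>p = ip \<beta> \<beta>\<close>,
    \<open>q = ip \<alpha> \<beta>\<close> makes \<open>p \<alpha> - q \<beta>\<close> orthogonal to
    \<beta>.\<close>
  have "0 \<le> (ip \<beta> \<beta>)\<^sup>2 * ip \<alpha> \<alpha> - 2 * ip \<beta> \<beta> * ip \<alpha> \<beta> * ip \<alpha> \<beta> + (ip \<alpha> \<beta>)\<^sup>2 * ip \<beta> \<beta>"
    by (rule ip_square_expand[OF assms])
  also have "\<dots> = ip \<beta> \<beta> * (ip \<alpha> \<alpha> * ip \<beta> \<beta> - (ip \<alpha> \<beta>)\<^sup>2)"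
    by (simp add: power2_eq_square algebra_simps)
  finally show ?thesis using ip_pos[OF assms(2)] by (simp add: zero_le_mult_iff)
qed

text \<open>Integrality excludes \<open>3 \<alpha>\<close>, so \<open>X \<alpha>\<close> commutes
  with the root vector of \<open>2 \<alpha>\<close>. It also commutes with the bracket of
  \<open>X (negf \<alpha>)\<close> and that vector, a multiple of \<open>X \<alpha>\<close>. By
  Jacobi \<open>H \<alpha>\<close> then annihilates the vector, although its eigenvalue there is
  \<open>4\<close>.\<close>

lemma double_not_root: assumes a: "\<alpha> \<in> \<Phi>" shows "(\<lambda>x. 2 * \<alpha> x) \<notin> \<Phi>"
proof
  let ?b = "\<lambda>x. 2 * \<alpha> x" and ?c = "\<lambda>x. 3 * \<alpha> x"
  assume b: "?b \<in> \<Phi>"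
  have c: "?c \<notin> \<Phi>"
  proof
    assume c: "?c \<in> \<Phi>"
    have "\<alpha> (H ?c) = 2 / 3" using root_H_self[OF c] by simp
    then obtain k where "(2::real) / 3 = of_int k" using root_H_int[OF c a] by (auto elim: Ints_cases)
    then have "(2::real) = of_int (3 * k)" by simp
    then have "2 = 3 * k" by linarith
    then show False by presburger
  qed
  have "addf \<alpha> ?b = ?c" by (simp add: fun_eq_iff)
  then have "br (X \<alpha>) (X ?b) = 0"
    using weight_not_root[OF dual_mult[OF root_dual[OF a], of 3] H_hR[OF a]] weight_br[OF weight_X[OF a] weight_X[OF b]] c
      root_H_self[OF a] by simp
  moreover have "addf (negf \<alpha>) ?b = \<alpha>" by (simp add: fun_eq_iff)
  then obtain d where "br (X (negf \<alpha>)) (X ?b) = d *\<^sub>R X \<alpha>"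
    using root_space[OF a] weight_br[OF weight_X[OF negf_root[OF a]] weight_X[OF b]] by metis
  ultimately have "br (br (X \<alpha>) (X (negf \<alpha>))) (X ?b) = 0"
    using jacobi[of "X \<alpha>" "X (negf \<alpha>)" "X ?b"] by (simp add: br_linear)
  then have "4 *\<^sub>R X ?b = 0"
    using br_X_negX[OF a] br_hX[OF b H_hR[OF a]] root_H_self[OF a] by (simp add: br_linear)
  then show False using X_nonzero[OF b] by simp
qed

text \<open>The integer \<open>\<alpha> (H (addf \<alpha> \<beta>))\<close> is \<open>2 * ip
  \<alpha> \<alpha> / (ip \<alpha> \<alpha> + ip \<beta> \<beta>)\<close>. It lies strictly between
  \<open>0\<close> and \<open>2\<close>, hence is \<open>1\<close>.\<close>

lemma orth_sum_root:
  assumes a: "\<alpha> \<in> \<Phi>" and b: "\<beta> \<in> \<Phi>" and o: "ip \<alpha> \<beta> = 0" and s: "addf \<alpha> \<beta> \<in> \<Phi>"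
  shows "ip \<beta> \<beta> = ip \<alpha> \<alpha>" and "ip (addf \<alpha> \<beta>) (addf \<alpha> \<beta>) = 2 * ip \<alpha> \<alpha>"
proof -
  have e: "ip \<alpha> (addf \<alpha> \<beta>) = ip \<alpha> \<alpha>" "ip \<beta> (addf \<alpha> \<beta>) = ip \<beta> \<beta>"
    using ip_addf[OF a b s a] ip_addf[OF a b s b] o by (simp_all add: ip_commute)
  have n: "ip (addf \<alpha> \<beta>) (addf \<alpha> \<beta>) = ip \<alpha> \<alpha> + ip \<beta> \<beta>"
    using ip_addf[OF a b s s] e by simp
  obtain k :: int where k: "\<alpha> (H (addf \<alpha> \<beta>)) = of_int k" using root_H_int[OF s a] by (auto elim: Ints_cases)
  have kk: "of_int k = 2 * ip \<alpha> \<alpha> / (ip \<alpha> \<alpha> + ip \<beta> \<beta>)" using root_H[OF a s] e n k by simp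
  have "ip \<alpha> \<alpha> > 0" "ip \<beta> \<beta> > 0" using ip_pos a b by auto
  then have "(of_int k :: real) > 0" "(of_int k :: real) < 2" unfolding kk by (auto simp: field_simps)
  then have "k = 1" by linarith
  then show "ip \<beta> \<beta> = ip \<alpha> \<alpha>" using kk ip_pos[OF a] ip_pos[OF b] by (simp add: field_simps)
  then show "ip (addf \<alpha> \<beta>) (addf \<alpha> \<beta>) = 2 * ip \<alpha> \<alpha>" using n by simp
qed

end

section \<open>Cayley rotations and root strings\<close>

context chevalley
begin

text \<open>By Jacobi \<open>br k\<close> is a derivation, so both sides satisfy the same linear
  equation: the flow consists of automorphisms.\<close>

lemma lin_flow_br:
  "lin_flow (br k) t (br x y) = br (lin_flow (br k) t x) (lin_flow (br k) t y)"
proof (rule linear_ode_unique[OF linear_br, symmetric])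
  have bb: "bounded_bilinear br"
    using linear_br linear_br_left by (simp add: bilinear_conv_bounded_bilinear[symmetric] bilinear_def)
  show "((\<lambda>t. br (lin_flow (br k) t x) (lin_flow (br k) t y)) has_vector_derivative
      br k (br (lin_flow (br k) t x) (lin_flow (br k) t y))) (at t)" for t
    using bounded_bilinear.has_vector_derivative[OF bb lin_flow_deriv[OF linear_br] lin_flow_deriv[OF linear_br]]
    by (simp add: jacobi[of k] add.commute)
qed simp

lemma lin_flow_inverse: "lin_flow (br k) t (lin_flow (br k) (- t) x) = x"
  by (simp add: lin_flow_add[OF linear_br])

lemma lin_flow_inverse': "lin_flow (br k) (- t) (lin_flow (br k) t x) = x"
  by (simp add: lin_flow_add[OF linear_br])

lemma br_X_eq_0:
  assumes "\<alpha> \<in> \<Phi>" "\<beta> \<in> \<Phi>" "ip \<alpha> \<beta> = 0" "addf \<alpha> \<beta> \<notin> \<Phi>"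
  shows "br (X \<alpha>) (X \<beta>) = 0"
proof -
  have "\<beta> (H \<alpha>) = 0" using assms by (simp add: ip_commute ip_eq_0_iff[symmetric])
  then show ?thesis
    using weight_not_root[OF dual_addf[OF root_dual root_dual] H_hR] weight_br[OF weight_X weight_X]
      root_H_self assms by force
qed

definition K :: "('a \<Rightarrow> real) \<Rightarrow> 'a" where
  "K \<alpha> = X \<alpha> + X (negf \<alpha>)"

text \<open>Completes \<open>H \<alpha>\<close> to a plane on which \<open>br (K \<alpha>)\<close>
  is an infinitesimal rotation of speed \<open>2\<close>.\<close>

definition Z :: "('a \<Rightarrow> real) \<Rightarrow> 'a" where
  "Z \<alpha> = X \<alpha> - X (negf \<alpha>)"

lemma br_K_h: assumes "\<alpha> \<in> \<Phi>" "h \<in> hR" shows "br (K \<alpha>) h = - (\<alpha> h *\<^sub>R Z \<alpha>)"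
  using br_anti[of "X \<alpha>" h] br_anti[of "X (negf \<alpha>)" h] br_hX[OF assms] br_hX[OF negf_root[OF assms(1)] assms(2)]
  by (simp add: K_def Z_def br_linear algebra_simps)

lemma br_K_Z: assumes "\<alpha> \<in> \<Phi>" shows "br (K \<alpha>) (Z \<alpha>) = 2 *\<^sub>R H \<alpha>"
  using br_anti[of "X (negf \<alpha>)" "X \<alpha>"] br_X_negX[OF assms]
  by (simp add: K_def Z_def br_linear scaleR_2)

lemma strongly_orthD:
  assumes "strongly_orth br hR \<alpha> \<beta>"
  shows "ip \<alpha> \<beta> = 0" "addf \<alpha> \<beta> \<notin> \<Phi>" "addf \<alpha> (negf \<beta>) \<notin> \<Phi>" "\<alpha> \<noteq> \<beta>"
  using assms by (auto simp: strongly_orth_def addf_def)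

lemma strongly_orth_br:
  assumes "\<alpha> \<in> \<Phi>" "\<beta> \<in> \<Phi>" "strongly_orth br hR \<alpha> \<beta>"
  shows "br (X \<alpha>) (X \<beta>) = 0" "br (X \<alpha>) (X (negf \<beta>)) = 0"
    "br (X (negf \<alpha>)) (X \<beta>) = 0" "br (X (negf \<alpha>)) (X (negf \<beta>)) = 0"
proof -
  note so = strongly_orthD[OF assms(3)]
  show 1: "br (X \<alpha>) (X \<beta>) = 0" and 2: "br (X \<alpha>) (X (negf \<beta>)) = 0"
    using br_X_eq_0 assms so negf_root ip_negf_right by auto
  show "br (X (negf \<alpha>)) (X \<beta>) = 0" "br (X (negf \<alpha>)) (X (negf \<beta>)) = 0"
    using tau_br[of "X \<alpha>" "X \<beta>"] tau_br[of "X \<alpha>" "X (negf \<beta>)"] 1 2 assms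
    by (simp_all add: tau_X negf_root linear_0[OF linear_tau])
qed

lemma strongly_orth_commute:
  assumes "\<alpha> \<in> \<Phi>" "\<beta> \<in> \<Phi>" "strongly_orth br hR \<alpha> \<beta>" shows "strongly_orth br hR \<beta> \<alpha>"
proof -
  have "negf (\<lambda>x. \<beta> x - \<alpha> x) = (\<lambda>x. \<alpha> x - \<beta> x)" by auto
  then have "(\<lambda>x. \<beta> x - \<alpha> x) \<notin> \<Phi>"
    using assms(3) negf_root[of "\<lambda>x. \<beta> x - \<alpha> x"] by (auto simp: strongly_orth_def)
  then show ?thesis using assms(3) by (auto simp: strongly_orth_def ip_commute add.commute)
qed

lemma br_K_X_strongly_orth:
  assumes "\<alpha> \<in> \<Phi>" "\<beta> \<in> \<Phi>" "strongly_orth br hR \<alpha> \<beta>" shows "br (K \<alpha>) (X \<beta>) = 0" "br (K \<alpha>) (X (negf \<beta>)) = 0"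
  using strongly_orth_br[OF assms] by (simp_all add: K_def br_linear)

text \<open>By strong orthogonality each \<open>K \<gamma>\<close> kills \<open>H \<beta>\<close>
  and \<open>Z \<beta>\<close> for the other \<beta> in \<open>M\<close>. So the flow turns the
  planes of \<open>H \<beta>\<close> and \<open>Z \<beta>\<close> independently with angular speed
  \<open>2\<close>.\<close>

lemma lin_flow_sum_K_h:
  assumes fin: "finite M" and M: "M \<subseteq> \<Phi>" and so: "pairwise_so br hR M" and h: "h \<in> hR"
  shows "lin_flow (br (\<Sum>\<beta>\<in>M. K \<beta>)) t h =
    h + (\<Sum>\<beta>\<in>M. \<beta> h *\<^sub>R (((cos (2 * t) - 1) / 2) *\<^sub>R H \<beta> - (sin (2 * t) / 2) *\<^sub>R Z \<beta>))"
proof (rule linear_ode_unique[OF linear_br, symmetric])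
  let ?D = "br (\<Sum>\<beta>\<in>M. K \<beta>)"
  let ?f = "\<lambda>t. h + (\<Sum>\<beta>\<in>M. \<beta> h *\<^sub>R (((cos (2 * t) - 1) / 2) *\<^sub>R H \<beta> - (sin (2 * t) / 2) *\<^sub>R Z \<beta>))"
  have DH: "?D (H \<beta>) = - 2 *\<^sub>R Z \<beta>" if b: "\<beta> \<in> M" for \<beta>
  proof -
    have "br (K \<gamma>) (H \<beta>) = (if \<gamma> = \<beta> then - 2 *\<^sub>R Z \<beta> else 0)" if "\<gamma> \<in> M" for \<gamma>
    proof (cases "\<gamma> = \<beta>")
      case False
      then have "\<gamma> (H \<beta>) = 0"
        using so that b M strongly_orthD(1) ip_eq_0_iff by (metis pairwise_so_def subsetD)
      then show ?thesis using br_K_h[of \<gamma> "H \<beta>"] H_hR that b M False by auto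
    qed (use br_K_h[of \<beta> "H \<beta>"] H_hR root_H_self b M in auto)
    then show ?thesis using fin b by (simp add: br_sum_left sum.delta cong: sum.cong)
  qed
  have DZ: "?D (Z \<beta>) = 2 *\<^sub>R H \<beta>" if b: "\<beta> \<in> M" for \<beta>
  proof -
    have "br (K \<gamma>) (Z \<beta>) = (if \<gamma> = \<beta> then 2 *\<^sub>R H \<beta> else 0)" if "\<gamma> \<in> M" for \<gamma>
    proof (cases "\<gamma> = \<beta>")
      case False
      then have "strongly_orth br hR \<gamma> \<beta>" using so that b by (auto simp: pairwise_so_def)
      then have "br (K \<gamma>) (X \<beta>) = 0" "br (K \<gamma>) (X (negf \<beta>)) = 0"
        using br_K_X_strongly_orth[of \<gamma> \<beta>] that b M by blast+
      then show ?thesis using False by (simp add: Z_def br_linear)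
    qed (use br_K_Z b M in auto)
    then show ?thesis using fin b by (simp add: br_sum_left sum.delta cong: sum.cong)
  qed
  have Dh: "?D h = (\<Sum>\<beta>\<in>M. - (\<beta> h *\<^sub>R Z \<beta>))"
    unfolding br_sum_left using br_K_h h M by (intro sum.cong) auto
  have Df: "?D (?f t) = (\<Sum>\<beta>\<in>M. \<beta> h *\<^sub>R ((- sin (2 * t)) *\<^sub>R H \<beta> - cos (2 * t) *\<^sub>R Z \<beta>))" for t
  proof -
    have "?D (?f t) = (\<Sum>\<beta>\<in>M. - (\<beta> h *\<^sub>R Z \<beta>)) + (\<Sum>\<beta>\<in>M. \<beta> h *\<^sub>R
        (((cos (2 * t) - 1) / 2) *\<^sub>R (- 2 *\<^sub>R Z \<beta>) - (sin (2 * t) / 2) *\<^sub>R (2 *\<^sub>R H \<beta>)))"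
      unfolding br_add_right br_sum_right Dh
      by (intro arg_cong2[of _ _ _ _ "(+)"] refl sum.cong) (simp add: br_linear DH DZ del: scaleR_scaleR)
    moreover have "- (a *\<^sub>R z) + a *\<^sub>R (((c - 1) / 2) *\<^sub>R (- 2 *\<^sub>R z) - (s / 2) *\<^sub>R (2 *\<^sub>R y))
        = a *\<^sub>R ((- s) *\<^sub>R y - c *\<^sub>R z)" for a c s :: real and y z :: 'a
    proof -
      have e: "(c - 1) / 2 * - 2 = 1 - c" by (simp add: field_simps)
      have 1: "((c - 1) / 2) *\<^sub>R (- 2 *\<^sub>R z) = (1 - c) *\<^sub>R z" unfolding scaleR_scaleR e ..
      have 2: "(s / 2) *\<^sub>R (2 *\<^sub>R y) = s *\<^sub>R y" by simp
      show ?thesis unfolding 1 2 by (simp add: algebra_simps)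
    qed
    ultimately show ?thesis by (simp only: sum.distrib[symmetric])
  qed
  show "(?f has_vector_derivative ?D (?f t)) (at t)" for t
  proof -
    have c: "((\<lambda>t. (cos (2 * t) - 1) / 2) has_real_derivative - sin (2 * t)) (at t)"
      and s: "((\<lambda>t. sin (2 * t) / 2) has_real_derivative cos (2 * t)) (at t)"
      by (auto intro!: derivative_eq_intros)
    have "(?f has_vector_derivative 0 + (\<Sum>\<beta>\<in>M. \<beta> h *\<^sub>R ((- sin (2 * t)) *\<^sub>R H \<beta> - cos (2 * t) *\<^sub>R Z \<beta>))) (at t)"
      by (intro has_vector_derivative_add has_vector_derivative_const has_vector_derivative_sum
          bounded_linear.has_vector_derivative[OF bounded_linear_scaleR_right]
          has_vector_derivative_diff bounded_linear.has_vector_derivative[OF bounded_linear_scaleR_left]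
          c[unfolded has_real_derivative_iff_has_vector_derivative]
          s[unfolded has_real_derivative_iff_has_vector_derivative])
    then show ?thesis by (simp add: Df)
  qed
qed simp

lemma lin_flow_sum_K_pi2_h:
  assumes "finite M" "M \<subseteq> \<Phi>" "pairwise_so br hR M" "h \<in> hR"
  shows "lin_flow (br (\<Sum>\<beta>\<in>M. K \<beta>)) (pi / 2) h = h - (\<Sum>\<beta>\<in>M. \<beta> h *\<^sub>R H \<beta>)"
  using lin_flow_sum_K_h[OF assms, of "pi / 2"] by (simp add: sum_negf)

section \<open>Reflections\<close>

lemma reflection_root:
  assumes g: "\<gamma> \<in> \<Phi>" and b: "\<beta> \<in> \<Phi>"
  shows "(\<lambda>x. \<gamma> x - \<gamma> (H \<beta>) * \<beta> x) \<in> \<Phi>"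
proof -
  \<comment> \<open>The reflection extends to the automorphism \<open>?w\<close> of the whole
    algebra, and \<open>?w (X \<gamma>)\<close> is a nonzero vector whose weight is the reflected
    root.\<close>
  let ?w = "lin_flow (br (K \<beta>)) (pi / 2)"
  let ?r = "\<lambda>h. h - \<beta> h *\<^sub>R H \<beta>"
  have r: "?r h \<in> hR" if "h \<in> hR" for h
    using that H_hR[OF b] subspace_diff[OF subspace_hR] subspace_scale[OF subspace_hR] by blast
  have w: "?w h = ?r h" if "h \<in> hR" for h
    using lin_flow_sum_K_pi2_h[of "{\<beta>}" h] that b by (simp add: pairwise_so_def)
  have br: "\<beta> (?r h) = - \<beta> h" and gr: "\<gamma> (?r h) = \<gamma> h - \<gamma> (H \<beta>) * \<beta> h" if "h \<in> hR" for h
    using that b g root_H_self[OF b] H_hR[OF b] subspace_scale[OF subspace_hR]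
    by (simp_all add: dual_diff[OF root_dual] dual_scale[OF root_dual])
  have wt: "weight (?w (X \<gamma>)) (\<lambda>x. \<gamma> x - \<gamma> (H \<beta>) * \<beta> x)"
    unfolding weight_def
  proof
    fix h assume h: "h \<in> hR"
    have "?w (?r h) = h" unfolding w[OF r[OF h]] br[OF h] by simp
    then have "br h (?w (X \<gamma>)) = ?w (br (?r h) (X \<gamma>))" by (simp add: lin_flow_br)
    also have "\<dots> = \<gamma> (?r h) *\<^sub>R ?w (X \<gamma>)"
      using br_hX[OF g r[OF h]] by (simp add: linear_scale[OF linear_lin_flow[OF linear_br]])
    finally show "br h (?w (X \<gamma>)) = (\<gamma> h - \<gamma> (H \<beta>) * \<beta> h) *\<^sub>R ?w (X \<gamma>)" by (simp only: gr[OF h])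
  qed
  have nz: "?w (X \<gamma>) \<noteq> 0"
    using X_nonzero[OF g] lin_flow_inverse'[of "K \<beta>" "pi / 2" "X \<gamma>"]
      linear_0[OF linear_lin_flow[OF linear_br]] by metis
  have dl: "(\<lambda>x. \<gamma> x - \<gamma> (H \<beta>) * \<beta> x) \<in> dualV hR"
    using root_dual[OF g] root_dual[OF b] by (auto simp: dualV_def algebra_simps)
  obtain h where h: "h \<in> hR" "\<gamma> h \<noteq> 0" using root_nonzero[OF g] by blast
  \<comment> \<open>\<open>?r\<close> is its own inverse, so the reflected root takes the nonzero
    value \<open>\<gamma> h\<close> at \<open>?r h\<close>.\<close>
  have e: "\<gamma> (?r h) - \<gamma> (H \<beta>) * \<beta> (?r h) = \<gamma> h"
    unfolding br[OF h(1)] gr[OF h(1)] by simp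
  show ?thesis
    by (rule rootI[OF dl r[OF h(1)] _ nz wt]) (unfold e, rule h(2))
qed

lemma ip_reflection:
  assumes "\<gamma> \<in> \<Phi>" "\<beta> \<in> \<Phi>" "\<delta> \<in> \<Phi>"
  shows "ip (\<lambda>x. \<gamma> x - \<gamma> (H \<beta>) * \<beta> x) \<delta> = ip \<gamma> \<delta> - \<gamma> (H \<beta>) * ip \<beta> \<delta>"
  using reflection_root[OF assms(1,2)] assms by (simp add: ip_root diff_divide_distrib)

lemma ip_reflection_self:
  assumes g: "\<gamma> \<in> \<Phi>" and b: "\<beta> \<in> \<Phi>"
  shows "ip (\<lambda>x. \<gamma> x - \<gamma> (H \<beta>) * \<beta> x) (\<lambda>x. \<gamma> x - \<gamma> (H \<beta>) * \<beta> x) = ip \<gamma> \<gamma>"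
proof -
  let ?r = "\<lambda>x. \<gamma> x - \<gamma> (H \<beta>) * \<beta> x"
  have r: "?r \<in> \<Phi>" by (rule reflection_root[OF g b])
  have "ip ?r ?r = ip \<gamma> ?r - \<gamma> (H \<beta>) * ip \<beta> ?r" by (rule ip_reflection[OF g b r])
  also have "\<dots> = ip ?r \<gamma> - \<gamma> (H \<beta>) * ip ?r \<beta>" by (simp only: ip_commute[of _ ?r])
  also have "\<dots> = ip \<gamma> \<gamma> - \<gamma> (H \<beta>) * (2 * ip \<gamma> \<beta> - \<gamma> (H \<beta>) * ip \<beta> \<beta>)"
    unfolding ip_reflection[OF g b g] ip_reflection[OF g b b] ip_commute[of \<beta> \<gamma>]
    by (simp add: algebra_simps)
  also have "\<dots> = ip \<gamma> \<gamma>"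
    using ip_pos[OF b] root_H[OF g b] by simp
  finally show ?thesis .
qed

section \<open>Root lengths within an irreducible component\<close>

lemma same_component_root: "same_component br hR \<alpha> \<beta> \<Longrightarrow> \<alpha> \<in> \<Phi> \<Longrightarrow> \<beta> \<in> \<Phi>"
  unfolding same_component_def by (induction rule: rtranclp_induct) auto

text \<open>Induction along the chain: if \<gamma> is orthogonal to the new end \<alpha>, reflecting
  it in the neighbour \<delta> keeps its length and destroys the orthogonality. Lengths in a
  component can thus be compared through non-orthogonal pairs.\<close>

lemma same_component_nonorth:
  assumes "same_component br hR \<alpha> \<beta>" "\<beta> \<in> \<Phi>"
  shows "\<exists>\<gamma>\<in>\<Phi>. ip \<gamma> \<gamma> = ip \<beta> \<beta> \<and> ip \<gamma> \<alpha> \<noteq> 0"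
  using assms(1) unfolding same_component_def
proof (induction rule: converse_rtranclp_induct)
  case base
  then show ?case using assms(2) ip_pos by fastforce
next
  case (step \<alpha> \<delta>)
  then obtain \<gamma> where g: "\<gamma> \<in> \<Phi>" "ip \<gamma> \<gamma> = ip \<beta> \<beta>" "ip \<gamma> \<delta> \<noteq> 0" by blast
  have d: "\<alpha> \<in> \<Phi>" "\<delta> \<in> \<Phi>" "ip \<delta> \<alpha> \<noteq> 0" using step by (auto simp: ip_commute)
  show ?case
  proof (cases "ip \<gamma> \<alpha> = 0")
    case True
    have "\<gamma> (H \<delta>) \<noteq> 0" using g d ip_eq_0_iff by blast
    then have "ip (\<lambda>x. \<gamma> x - \<gamma> (H \<delta>) * \<delta> x) \<alpha> \<noteq> 0" using True g d by (simp add: ip_reflection)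
    then show ?thesis
      using ip_reflection_self[OF g(1) d(2)] g(2) by (intro bexI[OF _ reflection_root[OF g(1) d(2)]]) simp
  qed (use g in blast)
qed

text \<open>The Cartan integers \<open>m < n\<close> are positive with \<open>m * n \<le> 4\<close>
  by Cauchy-Schwarz. So \<open>m = 1\<close>, the ratio is \<open>n\<close>, and
  \<open>n = 4\<close> would force \<zeta> to be \<open>2 \<alpha>\<close>.\<close>

lemma length_ratio_pos:
  assumes a: "\<alpha> \<in> \<Phi>" and z: "\<zeta> \<in> \<Phi>" and p: "ip \<zeta> \<alpha> > 0" and l: "ip \<zeta> \<zeta> > ip \<alpha> \<alpha>"
  shows "ip \<zeta> \<zeta> = 2 * ip \<alpha> \<alpha> \<or> ip \<zeta> \<zeta> = 3 * ip \<alpha> \<alpha>"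
proof -
  obtain m n :: int where m: "\<alpha> (H \<zeta>) = of_int m" and n: "\<zeta> (H \<alpha>) = of_int n"
    using root_H_int[OF z a] root_H_int[OF a z] by (auto elim!: Ints_cases)
  let ?A = "ip \<alpha> \<alpha>" and ?B = "ip \<zeta> \<zeta>" and ?P = "ip \<zeta> \<alpha>"
  have pos: "?A > 0" "?B > 0" using ip_pos a z by auto
  have mB: "of_int m * ?B = 2 * ?P" using root_H[OF a z] m pos by (simp add: field_simps ip_commute)
  have nA: "of_int n * ?A = 2 * ?P" using root_H[OF z a] n pos by (simp add: field_simps)
  have "of_int m * ?B > 0" using mB p by simp
  then have m1: "m \<ge> 1" using pos by (simp add: zero_less_mult_iff)
  have "m < n"
  proof (rule ccontr)
    assume "\<not> m < n"
    then have "of_int n * ?A \<le> of_int m * ?A" using pos by (intro mult_right_mono) auto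
    also have "\<dots> < of_int m * ?B" using m1 l by (intro mult_strict_left_mono) auto
    finally show False using mB nA by simp
  qed
  have "of_int (m * n) * (?A * ?B) = (of_int m * ?B) * (of_int n * ?A)" by (simp add: mult_ac)
  also have "\<dots> = 4 * ?P\<^sup>2" by (simp only: mB nA) (simp add: power2_eq_square)
  also have "\<dots> \<le> 4 * (?A * ?B)" using ip_cauchy_schwarz[OF z a] by (simp add: mult.commute)
  finally have "of_int (m * n) \<le> (4::real)" using pos by (simp add: mult_le_cancel_right)
  then have mn: "m * n \<le> 4" by linarith
  have "m = 1"
  proof (rule ccontr)
    assume "m \<noteq> 1"
    then have "2 * 3 \<le> m * n" using m1 \<open>m < n\<close> by (intro mult_mono) auto
    then show False using mn by simp
  qed
  then have nn: "n = 2 \<or> n = 3 \<or> n = 4" using mn \<open>m < n\<close> by auto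
  have B: "?B = of_int n * ?A" using mB nA \<open>m = 1\<close> by simp
  have "n \<noteq> 4"
  proof
    assume "n = 4"
    \<comment> \<open>This is the square norm of \<open>2 \<alpha> - \<zeta>\<close>, the case of
      equality in Cauchy-Schwarz.\<close>
    then have "2\<^sup>2 * ip \<alpha> \<alpha> - 2 * 2 * 1 * ip \<alpha> \<zeta> + 1\<^sup>2 * ip \<zeta> \<zeta> = 0"
      using B nA by (simp add: ip_commute[of \<alpha> \<zeta>])
    then have "2 * \<alpha> h = 1 * \<zeta> h" if "h \<in> hR" for h using ip_square_expand(2)[OF a z] that by blast
    then have "(\<lambda>x. 2 * \<alpha> x) = \<zeta>"
      by (intro dual_eqI dual_mult root_dual a z) auto
    then show False using double_not_root[OF a] z by simp
  qed
  then show ?thesis using nn B by auto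
qed

lemma length_ratio:
  assumes a: "\<alpha> \<in> \<Phi>" and z: "\<zeta> \<in> \<Phi>" and p: "ip \<zeta> \<alpha> \<noteq> 0" and l: "ip \<zeta> \<zeta> > ip \<alpha> \<alpha>"
  shows "ip \<zeta> \<zeta> = 2 * ip \<alpha> \<alpha> \<or> ip \<zeta> \<zeta> = 3 * ip \<alpha> \<alpha>"
proof (cases "ip \<zeta> \<alpha> > 0")
  case False
  have "ip (negf \<zeta>) (negf \<zeta>) = ip \<zeta> \<zeta>"
    using z by (simp add: ip_negf ip_negf_right negf_root)
  then show ?thesis
    using length_ratio_pos[OF a negf_root[OF z]] False p l by (simp add: ip_negf z a)
qed (use length_ratio_pos assms in blast)

text \<open>A longer root in the component would have \<open>4\<close> or \<open>6\<close> times the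
  square length of \<alpha> when compared with \<alpha> + \<beta>, but \<open>2\<close> or
  \<open>3\<close> times when compared with \<alpha> itself.\<close>

lemma orth_sum_long:
  assumes a: "\<alpha> \<in> \<Phi>" and b: "\<beta> \<in> \<Phi>" and o: "ip \<alpha> \<beta> = 0" and d: "addf \<alpha> \<beta> \<in> \<Phi>"
  shows "addf \<alpha> \<beta> \<in> long_roots br hR"
proof -
  let ?d = "addf \<alpha> \<beta>"
  have dd: "ip ?d ?d = 2 * ip \<alpha> \<alpha>" by (rule orth_sum_root[OF a b o d])
  have "ip ?d \<alpha> = ip \<alpha> \<alpha>" using ip_addf[OF a b d a] o by (simp add: ip_commute)
  then have ad: "ip \<alpha> ?d \<noteq> 0" using ip_pos[OF a] by (simp add: ip_commute)
  have "ip \<zeta> \<zeta> \<le> ip ?d ?d" if s: "same_component br hR ?d \<zeta>" for \<zeta>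
  proof (rule ccontr)
    assume n: "\<not> ip \<zeta> \<zeta> \<le> ip ?d ?d"
    have z: "\<zeta> \<in> \<Phi>" by (rule same_component_root[OF s d])
    have s': "same_component br hR \<alpha> \<zeta>"
      using s unfolding same_component_def
      by (rule converse_rtranclp_into_rtranclp[rotated]) (use ad a d in simp)
    obtain \<gamma> where g: "\<gamma> \<in> \<Phi>" "ip \<gamma> \<gamma> = ip \<zeta> \<zeta>" "ip \<gamma> ?d \<noteq> 0"
      using same_component_nonorth[OF s z] by blast
    obtain \<gamma>' where g': "\<gamma>' \<in> \<Phi>" "ip \<gamma>' \<gamma>' = ip \<zeta> \<zeta>" "ip \<gamma>' \<alpha> \<noteq> 0"
      using same_component_nonorth[OF s' z] by blast
    show False
      using length_ratio[OF d g(1,3)] length_ratio[OF a g'(1,3)] g(2) g'(2) dd n ip_pos[OF a] by linarith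
  qed
  then show ?thesis using d by (simp add: long_roots_def)
qed

lemma orth_sum_not_long:
  assumes a: "\<alpha> \<in> \<Phi>" and b: "\<beta> \<in> \<Phi>" and o: "ip \<alpha> \<beta> = 0" and d: "addf \<alpha> \<beta> \<in> \<Phi>"
  shows "\<alpha> \<notin> long_roots br hR"
proof
  let ?d = "addf \<alpha> \<beta>"
  assume "\<alpha> \<in> long_roots br hR"
  moreover have "ip ?d \<alpha> = ip \<alpha> \<alpha>" using ip_addf[OF a b d a] o by (simp add: ip_commute)
  then have "ip \<alpha> ?d \<noteq> 0" using ip_pos[OF a] by (simp add: ip_commute)
  then have "same_component br hR \<alpha> ?d" unfolding same_component_def using a d by auto
  ultimately have "ip ?d ?d \<le> ip \<alpha> \<alpha>" by (auto simp: long_roots_def)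
  then show False using orth_sum_root(2)[OF a b o d] ip_pos[OF a] by simp
qed

text \<open>A root \<delta> + \<gamma> or \<delta> - \<gamma> would be longer than \<delta> and lie
  in the same component.\<close>

lemma long_orth_strongly_orth:
  assumes d: "\<delta> \<in> long_roots br hR" and g: "\<gamma> \<in> \<Phi>" and o: "ip \<delta> \<gamma> = 0"
  shows "strongly_orth br hR \<delta> \<gamma>"
proof -
  have dr: "\<delta> \<in> \<Phi>" using d by (simp add: long_roots_def)
  have "addf \<delta> \<gamma> \<notin> \<Phi>" using orth_sum_not_long[OF dr g o] d by blast
  moreover have "addf \<delta> (negf \<gamma>) \<notin> \<Phi>"
    using orth_sum_not_long[OF dr negf_root[OF g]] d o by (auto simp: ip_negf_right dr g)
  moreover have "\<delta> \<noteq> \<gamma>" using o ip_pos[OF g] by auto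
  ultimately show ?thesis using o by (simp add: strongly_orth_def addf_def)
qed

section \<open>Strings through orthogonal roots\<close>

lemma orth_diff_root:
  assumes a: "\<alpha> \<in> \<Phi>" and b: "\<beta> \<in> \<Phi>" and o: "ip \<alpha> \<beta> = 0" and d: "addf \<alpha> \<beta> \<in> \<Phi>"
  shows "addf \<alpha> (negf \<beta>) \<in> \<Phi>"
proof -
  have "\<alpha> (H \<beta>) = 0" using o a b ip_eq_0_iff by blast
  \<comment> \<open>\<alpha> + \<beta> takes the value \<open>2\<close> at \<open>H \<beta>\<close>,
    so reflection in \<beta> sends it to \<alpha> - \<beta>.\<close>
  then show ?thesis using reflection_root[OF d b] root_H_self[OF b] by (simp add: addf_def)
qed

text \<open>Such a root would have \<open>5\<close> times the square length of \<alpha>, and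
  \<alpha> would take the value \<open>2 / 5\<close> at its coroot, which is not an integer.\<close>

lemma orth_sum_twice_not_root:
  assumes a: "\<alpha> \<in> \<Phi>" and b: "\<beta> \<in> \<Phi>" and o: "ip \<alpha> \<beta> = 0" and d: "addf \<alpha> \<beta> \<in> \<Phi>"
  shows "addf \<beta> (addf \<alpha> \<beta>) \<notin> \<Phi>"
proof
  let ?d = "addf \<alpha> \<beta>" and ?z = "addf \<beta> (addf \<alpha> \<beta>)"
  assume z: "?z \<in> \<Phi>"
  have bb: "ip \<beta> \<beta> = ip \<alpha> \<alpha>" and dd: "ip ?d ?d = 2 * ip \<alpha> \<alpha>"
    using orth_sum_root[OF a b o d] by auto
  have db: "ip ?d \<beta> = ip \<alpha> \<alpha>" using ip_addf[OF a b d b] o bb by simp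
  have da: "ip ?d \<alpha> = ip \<alpha> \<alpha>" using ip_addf[OF a b d a] o by (simp add: ip_commute)
  have za: "ip ?z \<alpha> = ip \<alpha> \<alpha>" using ip_addf[OF b d z a] o da by (simp add: ip_commute)
  have zb: "ip ?z \<beta> = 2 * ip \<alpha> \<alpha>" using ip_addf[OF b d z b] db bb by simp
  have zd: "ip ?z ?d = 3 * ip \<alpha> \<alpha>" using ip_addf[OF b d z d] db dd by (simp add: ip_commute[of \<beta> ?d])
  have "ip ?z ?z = 5 * ip \<alpha> \<alpha>"
    using ip_addf[OF b d z z] zb zd by (simp add: ip_commute[of \<beta> ?z] ip_commute[of ?d ?z])
  then have "\<alpha> (H ?z) = 2 / 5" using root_H[OF a z] za ip_pos[OF a] by (simp add: ip_commute[of \<alpha> ?z])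
  then obtain k where "(2::real) / 5 = of_int k" using root_H_int[OF z a] by (auto elim: Ints_cases)
  then have "(2::real) = of_int (5 * k)" by simp
  then have "2 = 5 * k" by linarith
  then show False by presburger
qed

text \<open>An sl2 computation at the upper end of the \<beta>-string through \<alpha>. The
  constants \<open>p\<close> and \<open>q\<close> depend on normalisations, but the eigenvalue
  \<open>2\<close> of \<open>H \<beta>\<close> on \<open>X (addf \<alpha> \<beta>)\<close> fixes
  their product.\<close>

lemma orth_sum_brackets:
  assumes a: "\<alpha> \<in> \<Phi>" and b: "\<beta> \<in> \<Phi>" and o: "ip \<alpha> \<beta> = 0" and d: "addf \<alpha> \<beta> \<in> \<Phi>"
  shows "br (X (negf \<beta>)) (br (X \<beta>) (X \<alpha>)) = - 2 *\<^sub>R X \<alpha>"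
    and "br (X \<beta>) (br (X \<beta>) (X \<alpha>)) = 0"
    and "\<exists>p. p \<noteq> 0 \<and> br (X \<beta>) (X \<alpha>) = p *\<^sub>R X (addf \<alpha> \<beta>)"
proof -
  let ?d = "addf \<alpha> \<beta>"
  have "addf \<beta> \<alpha> = ?d" "addf (negf \<beta>) ?d = \<alpha>" by (simp_all add: fun_eq_iff)
  then have w: "weight (br (X \<beta>) (X \<alpha>)) ?d" "weight (br (X (negf \<beta>)) (X ?d)) \<alpha>"
    using weight_br[OF weight_X[OF b] weight_X[OF a]]
      weight_br[OF weight_X[OF negf_root[OF b]] weight_X[OF d]] by simp_all
  obtain p where p: "br (X \<beta>) (X \<alpha>) = p *\<^sub>R X ?d" by (rule root_space[OF d w(1)])
  obtain q where q: "br (X (negf \<beta>)) (X ?d) = q *\<^sub>R X \<alpha>" by (rule root_space[OF a w(2)])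
  have db: "?d (H \<beta>) = 2" using o ip_eq_0_iff[OF a b] root_H_self[OF b] by simp
  have "addf \<beta> ?d (H \<beta>) \<noteq> 0" using db root_H_self[OF b] by simp
  then have z: "br (X \<beta>) (X ?d) = 0"
    by (rule weight_not_root[OF dual_addf[OF root_dual[OF b] root_dual[OF d]] H_hR[OF b] _
        weight_br[OF weight_X[OF b] weight_X[OF d]] orth_sum_twice_not_root[OF assms]])
  have "br (X \<beta>) (br (X (negf \<beta>)) (X ?d)) = - 2 *\<^sub>R X ?d"
    using jacobi[of "X \<beta>" "X (negf \<beta>)" "X ?d"] br_X_negX[OF b] br_hX[OF d H_hR[OF b]] db z
    by (simp add: br_linear)
  then have pq: "q * p = - 2" using X_nonzero[OF d] unfolding q br_scale_right p scaleR_scaleR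
    by (simp only: scaleR_cancel_right) simp
  then show "br (X (negf \<beta>)) (br (X \<beta>) (X \<alpha>)) = - 2 *\<^sub>R X \<alpha>"
    unfolding p br_scale_right q scaleR_scaleR by (simp add: mult.commute)
  show "br (X \<beta>) (br (X \<beta>) (X \<alpha>)) = 0" unfolding p br_scale_right z by simp
  show "\<exists>p. p \<noteq> 0 \<and> br (X \<beta>) (X \<alpha>) = p *\<^sub>R X ?d" using pq p by (intro exI[of _ p]) auto
qed

text \<open>In the square of \<open>br (K \<beta>)\<close> the two pure terms vanish, since the
  string stops at \<alpha> + \<beta> and \<alpha> - \<beta>; each of the two mixed terms contributes
  \<open>- 2\<close>.\<close>

lemma br_K_twice:
  assumes a: "\<alpha> \<in> \<Phi>" and b: "\<beta> \<in> \<Phi>" and o: "ip \<alpha> \<beta> = 0" and d: "addf \<alpha> \<beta> \<in> \<Phi>"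
  shows "br (K \<beta>) (br (K \<beta>) (X \<alpha>)) = - 4 *\<^sub>R X \<alpha>"
proof -
  have "ip \<alpha> (negf \<beta>) = 0" using o a b by (simp add: ip_negf_right)
  then have c: "br (X \<beta>) (br (X (negf \<beta>)) (X \<alpha>)) = - 2 *\<^sub>R X \<alpha>"
    "br (X (negf \<beta>)) (br (X (negf \<beta>)) (X \<alpha>)) = 0"
    using orth_sum_brackets(1,2)[OF a negf_root[OF b] _ orth_diff_root[OF assms]] by simp_all
  have "- 2 *\<^sub>R X \<alpha> + - 2 *\<^sub>R X \<alpha> = - 4 *\<^sub>R X \<alpha>"
    unfolding scaleR_left_distrib[symmetric] by simp
  then show ?thesis
    by (simp only: K_def br_add_left br_add_right c orth_sum_brackets(1,2)[OF assms] add_0_left add_0_right)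
qed

lemma lin_flow_fixed: assumes "br k v = 0" shows "lin_flow (br k) t v = v"
  by (rule linear_ode_unique[OF linear_br, symmetric]) (auto simp: assms)

text \<open>On the span of \<open>v\<close> and \<open>br k v\<close> the flow turns with angular
  speed \<open>2\<close>, so time \<open>pi / 2\<close> is a half turn.\<close>

lemma lin_flow_rotation:
  assumes k: "br k (br k v) = - 4 *\<^sub>R v"
  shows "lin_flow (br k) (pi / 2) v = - v"
proof -
  have "lin_flow (br k) t v = cos (2 * t) *\<^sub>R v + (sin (2 * t) / 2) *\<^sub>R br k v" for t
  proof (rule linear_ode_unique[OF linear_br, symmetric])
    fix t :: real
    have c: "((\<lambda>t. cos (2 * t)) has_real_derivative - 2 * sin (2 * t)) (at t)"
      and s: "((\<lambda>t. sin (2 * t) / 2) has_real_derivative cos (2 * t)) (at t)"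
      by (auto intro!: derivative_eq_intros)
    have "((\<lambda>t. cos (2 * t) *\<^sub>R v + (sin (2 * t) / 2) *\<^sub>R br k v) has_vector_derivative
        (- 2 * sin (2 * t)) *\<^sub>R v + cos (2 * t) *\<^sub>R br k v) (at t)"
      by (intro has_vector_derivative_add bounded_linear.has_vector_derivative[OF bounded_linear_scaleR_left]
          c[unfolded has_real_derivative_iff_has_vector_derivative]
          s[unfolded has_real_derivative_iff_has_vector_derivative])
    moreover have "br k (cos (2 * t) *\<^sub>R v + (sin (2 * t) / 2) *\<^sub>R br k v)
        = (- 2 * sin (2 * t)) *\<^sub>R v + cos (2 * t) *\<^sub>R br k v"
      unfolding br_add_right br_scale_right k by simp
    ultimately show "((\<lambda>t. cos (2 * t) *\<^sub>R v + (sin (2 * t) / 2) *\<^sub>R br k v) has_vector_derivative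
        br k (cos (2 * t) *\<^sub>R v + (sin (2 * t) / 2) *\<^sub>R br k v)) (at t)" by simp
  qed simp
  from this[of "pi / 2"] show ?thesis by simp
qed

end

section \<open>Involutions\<close>

lemma involution_inv: "(\<And>x. f (f x) = x) \<Longrightarrow> inv f = f"
  by (rule inv_equality)

lemma involution_image: "(\<And>x. f (f x) = x) \<Longrightarrow> (\<And>x. x \<in> S \<Longrightarrow> f x \<in> S) \<Longrightarrow> f ` S = S"
  by (metis image_eqI image_subsetI subsetI subset_antisym)

context chevalley
begin

text \<open>An involution is its own inverse, and roots vanish off \<open>hR\<close>, so the
  equation of functionals only concerns \<open>hR\<close>.\<close>

lemma imag_roots_rho:
  assumes "\<And>x. f (f x) = x"
  shows "imag_roots br hR (rho hR f) = {\<alpha>\<in>\<Phi>. \<forall>h\<in>hR. \<alpha> (f h) = - \<alpha> h}"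
proof -
  have "rho hR f \<alpha> = negf \<alpha> \<longleftrightarrow> (\<forall>h\<in>hR. \<alpha> (f h) = - \<alpha> h)" if "\<alpha> \<in> \<Phi>" for \<alpha>
    unfolding rho_def involution_inv[of f, OF assms] fun_eq_iff
    using dual_outside[OF root_dual[OF that]] by auto
  then show ?thesis by (auto simp: imag_roots_def)
qed

text \<open>The two components of \<open>gfix \<tau>\<close> are the eigenspaces of \<tau> for
  \<open>1\<close> and \<open>-1\<close>, so \<open>f\<close> preserves both. Splitting
  \<open>x\<close> into its eigenparts \<open>?p\<close> and \<open>?m\<close> gives the
  commutation.\<close>

lemma Inv_tau_commute:
  assumes "f \<in> Inv_tau br hR \<tau>" shows "f (\<tau> x) = \<tau> (f x)"
proof -
  have f: "linear f" and im: "antilin_ext f ` gfix \<tau> = gfix \<tau>"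
    using assms by (auto simp: Inv_tau_def lie_aut_def)
  have g: "antilin_ext f u \<in> gfix \<tau>" if "u \<in> gfix \<tau>" for u using im that by blast
  have p: "\<tau> (f y) = f y" if "\<tau> y = y" for y
    using g[of "(y, 0)"] that linear_0[OF linear_tau] by (simp add: gfix_def antilin_ext_def)
  have m: "\<tau> (f y) = - f y" if "\<tau> y = - y" for y
    using g[of "(0, y)"] that linear_0[OF linear_tau] linear_neg[OF linear_tau, of "f y"]
    by (simp add: gfix_def antilin_ext_def minus_equation_iff[of _ "f y"])
  let ?p = "(1/2) *\<^sub>R (x + \<tau> x)" and ?m = "(1/2) *\<^sub>R (x - \<tau> x)"
  have "\<tau> ?p = ?p" "\<tau> ?m = - ?m"
    by (simp_all add: linear_scale[OF linear_tau] linear_add[OF linear_tau] linear_diff[OF linear_tau]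
        add.commute scaleR_diff_right)
  then have fp: "\<tau> (f ?p) = f ?p" and fm: "\<tau> (f ?m) = - f ?m" using p m by blast+
  have x: "x = ?p + ?m" and tx: "\<tau> x = ?p - ?m"
    by (simp_all add: scaleR_add_right[symmetric] scaleR_diff_right[symmetric] scaleR_2[symmetric])
  have "f (\<tau> x) = f ?p - f ?m" by (subst tx) (rule linear_diff[OF f])
  also have "\<dots> = \<tau> (f ?p) + \<tau> (f ?m)" by (simp only: fp fm) simp
  also have "\<dots> = \<tau> (f (?p + ?m))" by (simp only: linear_add[OF f] linear_add[OF linear_tau])
  finally show ?thesis by (simp only: x[symmetric])
qed

lemma Inv_tauI:
  assumes "lie_aut br f" and ff: "\<And>x. f (f x) = x" and "\<And>h. h \<in> hR \<Longrightarrow> f h \<in> hR"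
    and t: "\<And>x. f (\<tau> x) = \<tau> (f x)"
  shows "f \<in> Inv_tau br hR \<tau>"
proof -
  have f: "linear f" using assms(1) by (simp add: lie_aut_def)
  have "antilin_ext f ` gfix \<tau> = gfix \<tau>"
  proof (rule involution_image)
    show "antilin_ext f (antilin_ext f u) = u" for u
      by (simp add: antilin_ext_def linear_neg[OF f] ff)
    show "antilin_ext f u \<in> gfix \<tau>" if "u \<in> gfix \<tau>" for u
      using that by (simp add: antilin_ext_def gfix_def linear_neg[OF f] linear_neg[OF linear_tau] t[symmetric])
  qed
  then show ?thesis using assms involution_image[of f hR] by (simp add: Inv_tau_def)
qed

end

section \<open>Signs of an involution on imaginary root vectors\<close>

locale chevalley_involution = chevalley +
  fixes \<sigma> :: "'a \<Rightarrow> 'a"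
  assumes sigma_in: "\<sigma> \<in> Inv_tau br hR \<tau>"
begin

abbreviation nc :: "('a \<Rightarrow> real) set" where "nc \<equiv> noncompact_imag br hR X \<sigma>"
abbreviation imag :: "('a \<Rightarrow> real) set" where "imag \<equiv> imag_roots br hR (rho hR \<sigma>)"

lemma linear_sigma: "linear \<sigma>" and sigma_br: "\<sigma> (br x y) = br (\<sigma> x) (\<sigma> y)"
  and sigma_sigma [simp]: "\<sigma> (\<sigma> x) = x" and sigma_hR: "h \<in> hR \<Longrightarrow> \<sigma> h \<in> hR"
  using sigma_in by (auto simp: Inv_tau_def lie_aut_def)

lemmas sigma_tau = Inv_tau_commute[OF sigma_in]

lemma imag_iff: "\<alpha> \<in> imag \<longleftrightarrow> \<alpha> \<in> \<Phi> \<and> (\<forall>h\<in>hR. \<alpha> (\<sigma> h) = - \<alpha> h)"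
  by (simp add: imag_roots_rho)

lemma imag_root: "\<alpha> \<in> imag \<Longrightarrow> \<alpha> \<in> \<Phi>"
  by (simp add: imag_iff)

lemma imag_negf: "\<alpha> \<in> imag \<Longrightarrow> negf \<alpha> \<in> imag"
  by (simp add: imag_iff negf_root)

lemma imag_addf: "\<alpha> \<in> imag \<Longrightarrow> \<beta> \<in> imag \<Longrightarrow> addf \<alpha> \<beta> \<in> \<Phi> \<Longrightarrow> addf \<alpha> \<beta> \<in> imag"
  by (simp add: imag_iff)

lemma nc_iff: "\<alpha> \<in> nc \<longleftrightarrow> \<alpha> \<in> imag \<and> \<sigma> (X \<alpha>) = - X (negf \<alpha>)"
  by (simp add: noncompact_imag_def)

lemma finite_nc: "finite nc"
  by (rule finite_subset[OF _ finite_roots]) (auto simp: nc_iff imag_root)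

text \<open>\<tau> exchanges opposite root vectors and commutes with \<sigma>, so the scalar is the
  same on both.\<close>

lemma sigma_X_negf:
  assumes "\<alpha> \<in> \<Phi>" "\<sigma> (X \<alpha>) = c *\<^sub>R X (negf \<alpha>)" shows "\<sigma> (X (negf \<alpha>)) = c *\<^sub>R X \<alpha>"
proof -
  have "\<sigma> (X (negf \<alpha>)) = \<tau> (\<sigma> (X \<alpha>))" using sigma_tau tau_X[OF assms(1)] by metis
  also have "\<dots> = c *\<^sub>R X \<alpha>"
    using tau_X[OF negf_root[OF assms(1)]] by (simp add: assms(2) linear_scale[OF linear_tau])
  finally show ?thesis .
qed

text \<open>The image has weight \<open>negf \<alpha>\<close>, hence is a multiple \<open>c\<close>
  of \<open>X (negf \<alpha>)\<close>. The same \<open>c\<close> occurs on the way back, so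
  \<open>c * c = 1\<close>.\<close>

lemma sigma_X_imag:
  assumes a: "\<alpha> \<in> imag" shows "\<sigma> (X \<alpha>) = X (negf \<alpha>) \<or> \<sigma> (X \<alpha>) = - X (negf \<alpha>)"
proof -
  have r: "\<alpha> \<in> \<Phi>" using a by (rule imag_root)
  have "weight (\<sigma> (X \<alpha>)) (negf \<alpha>)"
    unfolding weight_def
  proof
    fix h assume h: "h \<in> hR"
    have "br h (\<sigma> (X \<alpha>)) = \<sigma> (br (\<sigma> h) (X \<alpha>))" by (simp add: sigma_br)
    also have "\<dots> = \<alpha> (\<sigma> h) *\<^sub>R \<sigma> (X \<alpha>)"
      using br_hX[OF r sigma_hR[OF h]] by (simp add: linear_scale[OF linear_sigma])
    finally show "br h (\<sigma> (X \<alpha>)) = negf \<alpha> h *\<^sub>R \<sigma> (X \<alpha>)" using a h by (simp add: imag_iff)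
  qed
  then obtain c where c: "\<sigma> (X \<alpha>) = c *\<^sub>R X (negf \<alpha>)" using root_space[OF negf_root[OF r]] by blast
  have "X \<alpha> = \<sigma> (\<sigma> (X \<alpha>))" by simp
  also have "\<dots> = (c * c) *\<^sub>R X \<alpha>"
    unfolding c linear_scale[OF linear_sigma] sigma_X_negf[OF r c] by simp
  finally have "(1 - c * c) *\<^sub>R X \<alpha> = 0" by (simp add: algebra_simps)
  then have "c * c = 1" using X_nonzero[OF r] by simp
  then have "c = 1 \<or> c = - 1" by (simp add: square_eq_1_iff)
  then show ?thesis using c by auto
qed

lemma nc_negf: "\<alpha> \<in> nc \<Longrightarrow> negf \<alpha> \<in> nc"
  using sigma_X_negf[of \<alpha> "-1"] by (simp add: nc_iff imag_negf imag_root)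

text \<open>The sign \<open>\<sigma> X\<^sub>\<alpha> = \<plusminus> X\<^sub>-\<^sub>\<alpha>\<close> is multiplicative because \<open>\<sigma>\<close> commutes with \<open>\<tau>\<close>.\<close>
lemma nc_addf:
  assumes a: "\<alpha> \<in> imag" "\<sigma> (X \<alpha>) = X (negf \<alpha>)" and b: "\<beta> \<in> nc"
    and o: "ip \<alpha> \<beta> = 0" and d: "addf \<alpha> \<beta> \<in> \<Phi>"
  shows "addf \<alpha> \<beta> \<in> nc"
proof -
  have r: "\<alpha> \<in> \<Phi>" "\<beta> \<in> \<Phi>" "\<beta> \<in> imag" using a b by (auto simp: nc_iff imag_root)
  obtain p where p: "p \<noteq> 0" "br (X \<beta>) (X \<alpha>) = p *\<^sub>R X (addf \<alpha> \<beta>)"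
    using orth_sum_brackets(3)[OF r(1,2) o d] by blast
  have "p *\<^sub>R \<sigma> (X (addf \<alpha> \<beta>)) = \<sigma> (br (X \<beta>) (X \<alpha>))" by (simp add: p linear_scale[OF linear_sigma])
  also have "\<dots> = - \<tau> (br (X \<beta>) (X \<alpha>))"
    using a b r by (simp add: sigma_br tau_br tau_X nc_iff br_linear)
  also have "\<dots> = p *\<^sub>R (- X (negf (addf \<alpha> \<beta>)))"
    by (simp add: p linear_scale[OF linear_tau] tau_X[OF d])
  finally have "\<sigma> (X (addf \<alpha> \<beta>)) = - X (negf (addf \<alpha> \<beta>))" using p(1) by (simp only: scaleR_cancel_left) simp
  then show ?thesis using imag_addf[OF a(1) r(3) d] by (simp add: nc_iff)
qed

lemma sigma_H: assumes "\<beta> \<in> nc" shows "\<sigma> (H \<beta>) = - H \<beta>"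
proof -
  have b: "\<beta> \<in> \<Phi>" "negf \<beta> \<in> nc" using assms nc_negf by (auto simp: nc_iff imag_root)
  have "\<sigma> (H \<beta>) = - br (\<sigma> (X \<beta>)) (\<sigma> (X (negf \<beta>)))"
    by (simp add: sigma_br[symmetric] br_X_negX[OF b(1)] linear_neg[OF linear_sigma])
  also have "\<dots> = - br (X (negf \<beta>)) (X \<beta>)" using assms b(2) by (simp add: nc_iff br_linear)
  also have "\<dots> = - H \<beta>" using br_X_negX[OF b(1)] br_anti[of "X (negf \<beta>)" "X \<beta>"] by simp
  finally show ?thesis .
qed

lemma sigma_K: assumes "\<beta> \<in> nc" shows "\<sigma> (K \<beta>) = - K \<beta>"
  using assms nc_negf[OF assms] by (simp add: K_def nc_iff linear_add[OF linear_sigma])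

lemma tau_K: assumes "\<beta> \<in> \<Phi>" shows "\<tau> (K \<beta>) = K \<beta>"
  using assms by (simp add: K_def linear_add[OF linear_tau] tau_X negf_root)

text \<open>The choice of \<open>M\<close> is a comparison with maximal sets only. Enlarging a set
  built by hand makes the comparison applicable and loses no long root.\<close>

lemma pairwise_so_extend_maximal:
  assumes "B \<subseteq> nc" "pairwise_so br hR B"
  obtains C where "B \<subseteq> C" "C \<subseteq> nc" "pairwise_so br hR C"
    "\<forall>D. C \<subseteq> D \<and> D \<subseteq> nc \<and> pairwise_so br hR D \<longrightarrow> D = C"
proof -
  let ?F = "{C. C \<subseteq> nc \<and> pairwise_so br hR C}"
  have "finite ?F" using finite_nc by (auto intro: finite_subset[OF _ finite_Pow_iff[THEN iffD2]])
  moreover have "B \<in> ?F" using assms by simp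
  ultimately obtain C where C: "C \<in> ?F" "B \<subseteq> C" and max: "\<forall>D\<in>?F. C \<subseteq> D \<longrightarrow> C = D"
    using finite_has_maximal2[of ?F B] by blast
  show ?thesis
  proof (rule that[of C])
    show "\<forall>D. C \<subseteq> D \<and> D \<subseteq> nc \<and> pairwise_so br hR D \<longrightarrow> D = C"
      using max by auto
  qed (use C in simp_all)
qed

end

section \<open>Exchange argument for \<open>M\<close>\<close>

locale cayley = chevalley_involution +
  fixes M :: "('a \<Rightarrow> real) set"
  assumes M_sub: "M \<subseteq> nc"
    and M_so: "pairwise_so br hR M"
    and M_max: "\<forall>B. M \<subseteq> B \<and> B \<subseteq> nc \<and> pairwise_so br hR B \<longrightarrow> B = M"
    and M_long: "\<forall>B. B \<subseteq> nc \<and> pairwise_so br hR B \<and>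
                   (\<forall>C. B \<subseteq> C \<and> C \<subseteq> nc \<and> pairwise_so br hR C \<longrightarrow> C = B)
                   \<longrightarrow> card (B \<inter> long_roots br hR) \<le> card (M \<inter> long_roots br hR)"
begin

lemma M_root: "M \<subseteq> \<Phi>"
  using M_sub by (auto simp: nc_iff imag_root)

lemma finite_M: "finite M"
  using finite_subset[OF M_root finite_roots] .

lemma M_strongly_orth: "\<beta> \<in> M \<Longrightarrow> \<gamma> \<in> M \<Longrightarrow> \<beta> \<noteq> \<gamma> \<Longrightarrow> strongly_orth br hR \<beta> \<gamma>"
  using M_so by (simp add: pairwise_so_def)

text \<open>If \<open>\<alpha>\<close> is compact, orthogonal but not strongly orthogonal to \<open>\<beta> \<in> M\<close>, then trading the short
  root \<open>\<beta>\<close> for the two long roots \<open>\<alpha> \<plusminus> \<beta>\<close> contradicts the choice of \<open>M\<close>.\<close>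
lemma compact_orth_sum_not_root:
  assumes a: "\<alpha> \<in> imag" "\<sigma> (X \<alpha>) = X (negf \<alpha>)" and o: "\<And>\<beta>. \<beta> \<in> M \<Longrightarrow> ip \<alpha> \<beta> = 0"
    and b: "\<beta> \<in> M"
  shows "addf \<alpha> \<beta> \<notin> \<Phi>"
proof
  let ?p = "addf \<alpha> \<beta>" and ?m = "addf \<alpha> (negf \<beta>)" and ?L = "long_roots br hR"
  let ?B = "(M - {\<beta>}) \<union> {?p, ?m}"
  assume p: "?p \<in> \<Phi>"
  have ar: "\<alpha> \<in> \<Phi>" and br: "\<beta> \<in> \<Phi>" and bn: "\<beta> \<in> nc"
    using a b M_root M_sub by (auto simp: imag_root)
  have ob: "ip \<alpha> \<beta> = 0" by (rule o[OF b])
  have ob': "ip \<alpha> (negf \<beta>) = 0" using ob by (simp add: ip_negf_right ar br)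
  have m: "?m \<in> \<Phi>" by (rule orth_diff_root[OF ar br ob p])
  have pL: "?p \<in> ?L" and mL: "?m \<in> ?L"
    using orth_sum_long[OF ar br ob p] orth_sum_long[OF ar negf_root[OF br] ob' m] by auto
  have bb: "ip \<beta> \<beta> = ip \<alpha> \<alpha>" and pp: "ip ?p ?p = 2 * ip \<alpha> \<alpha>" using orth_sum_root[OF ar br ob p] by auto
  have pb: "ip ?p \<beta> = ip \<alpha> \<alpha>" using ip_addf[OF ar br p br] ob bb by simp
  have pa: "ip ?p \<alpha> = ip \<alpha> \<alpha>" using ip_addf[OF ar br p ar] ob by (simp add: ip_commute)
  \<comment> \<open>\<alpha> and \<beta> have equal length, so their sum and difference are
    orthogonal.\<close>
  have "ip ?m ?p = 0"
    using ip_addf[OF ar negf_root[OF br] m p] pa pb ip_negf[OF br p]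
    by (simp add: ip_commute[of \<alpha> ?p] ip_commute[of \<beta> ?p])
  then have mp: "strongly_orth br hR ?m ?p" by (rule long_orth_strongly_orth[OF mL p])
  \<comment> \<open>\<alpha> and \<beta> are both orthogonal to the rest of \<open>M\<close>; for
    the long roots \<open>?p\<close> and \<open>?m\<close> orthogonality is already strong.\<close>
  have g: "strongly_orth br hR ?p \<gamma>" "strongly_orth br hR ?m \<gamma>" if "\<gamma> \<in> M - {\<beta>}" for \<gamma>
  proof -
    have gr: "\<gamma> \<in> \<Phi>" using that M_root by blast
    have "ip \<alpha> \<gamma> = 0" "ip \<beta> \<gamma> = 0" using that o M_strongly_orth[OF b] strongly_orthD(1) by auto
    then have "ip ?p \<gamma> = 0" "ip ?m \<gamma> = 0"
      using ip_addf[OF ar br p gr] ip_addf[OF ar negf_root[OF br] m gr] ip_negf[OF br gr] by auto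
    then show "strongly_orth br hR ?p \<gamma>" "strongly_orth br hR ?m \<gamma>"
      using long_orth_strongly_orth pL mL gr by auto
  qed
  have Br: "?B \<subseteq> \<Phi>" using M_root p m by auto
  have "strongly_orth br hR x y" if xy: "x \<in> ?B" "y \<in> ?B" "x \<noteq> y" for x y
  proof -
    consider "x \<in> M - {\<beta>}" "y \<in> M - {\<beta>}" | "x \<in> {?p, ?m}" "y \<in> M - {\<beta>}"
      | "y \<in> {?p, ?m}" "x \<in> M - {\<beta>}" | "x = ?m" "y = ?p" | "x = ?p" "y = ?m"
      using xy by auto
    then show ?thesis
    proof cases
      case 1
      then show ?thesis using M_strongly_orth xy by simp
    next
      case 2
      then show ?thesis using g by auto
    next
      case 3
      then have "strongly_orth br hR y x" using g by auto
      then show ?thesis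
        by (rule strongly_orth_commute[OF subsetD[OF Br xy(2)] subsetD[OF Br xy(1)]])
    next
      case 4
      then show ?thesis using mp by simp
    next
      case 5
      then show ?thesis using strongly_orth_commute[OF m p mp] by simp
    qed
  qed
  then have Bso: "pairwise_so br hR ?B" by (simp add: pairwise_so_def)
  have "?p \<in> nc" "?m \<in> nc"
    using nc_addf[OF a bn ob p] nc_addf[OF a nc_negf[OF bn] ob' m] by auto
  then have Bn: "?B \<subseteq> nc" using M_sub by auto
  \<comment> \<open>\<open>?B\<close> need not be maximal, so the count is made for a maximal
    \<open>C\<close> above it.\<close>
  obtain C where C: "?B \<subseteq> C" "C \<subseteq> nc" "pairwise_so br hR C"
    "\<forall>D. C \<subseteq> D \<and> D \<subseteq> nc \<and> pairwise_so br hR D \<longrightarrow> D = C"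
    by (rule pairwise_so_extend_maximal[OF Bn Bso])
  \<comment> \<open>The removed \<beta> is not long, so no long root of \<open>M\<close> is
    lost.\<close>
  have "addf \<beta> \<alpha> = ?p" by (simp add: fun_eq_iff)
  then have "\<beta> \<notin> ?L" using orth_sum_not_long[OF br ar] ob p by (simp add: ip_commute)
  then have sub: "M \<inter> ?L \<subseteq> C \<inter> ?L" using C(1) by blast
  \<comment> \<open>The long root \<open>?p\<close> is gained: it differs from \<beta> in length and
    is not orthogonal to it, so it is not in \<open>M\<close>.\<close>
  have "?p \<noteq> \<beta>" using pp bb ip_pos[OF ar] by auto
  then have "?p \<notin> M" using M_strongly_orth[of ?p \<beta>] strongly_orthD(1)[of ?p \<beta>] b pb ip_pos[OF ar] by auto
  then have "M \<inter> ?L \<subset> C \<inter> ?L" using sub C(1) pL by blast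
  moreover have "finite C" by (rule finite_subset[OF C(2) finite_nc])
  ultimately have "card (M \<inter> ?L) < card (C \<inter> ?L)" by (intro psubset_card_mono) auto
  moreover have "card (C \<inter> ?L) \<le> card (M \<inter> ?L)" using spec[OF M_long, of C] C(2-4) by simp
  ultimately show False by simp
qed

section \<open>The conjugated involution\<close>

definition k :: 'a where "k = (\<Sum>\<beta>\<in>M. K \<beta>)"

abbreviation E :: "real \<Rightarrow> 'a \<Rightarrow> 'a" where "E \<equiv> lin_flow (br k)"

text \<open>\<sigma> reverses the flow, so the two factors at time \<open>pi / 4\<close> add up to
  the half turn at \<open>pi / 2\<close>.\<close>

definition \<sigma>' :: "'a \<Rightarrow> 'a" where "\<sigma>' x = E (pi / 4) (\<sigma> (E (- (pi / 4)) x))"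

lemma linear_E: "linear (E t)"
  by (rule linear_lin_flow[OF linear_br])

text \<open>The roots of \<open>M\<close> are noncompact, so \<sigma> negates \<open>k\<close> and
  anticommutes with \<open>br k\<close>.\<close>

lemma sigma_E: "\<sigma> (E t x) = E (- t) (\<sigma> x)"
proof -
  have "\<sigma> k = - k" using M_sub sigma_K by (simp add: k_def linear_sum[OF linear_sigma] sum_negf[symmetric] subset_iff)
  then have "\<sigma> (br k x) = - br k (\<sigma> x)" for x by (simp add: sigma_br br_linear)
  then show ?thesis
    using lin_flow_intertwine[OF linear_br linear_compose_neg[OF linear_br] linear_sigma]
    by (simp add: lin_flow_uminus[OF linear_br])
qed

lemma tau_E: "\<tau> (E t x) = E t (\<tau> x)"
proof -
  have "\<tau> k = k" using M_root tau_K by (simp add: k_def linear_sum[OF linear_tau] subset_iff)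
  then have "\<tau> (br k x) = br k (\<tau> x)" for x by (simp add: tau_br)
  then show ?thesis using lin_flow_intertwine[OF linear_br linear_br linear_tau] by blast
qed

lemma sigma'_eq: "\<sigma>' x = E (pi / 2) (\<sigma> x)"
  by (simp add: \<sigma>'_def sigma_E lin_flow_add[OF linear_br])

lemma sigma'_sigma': "\<sigma>' (\<sigma>' x) = x"
  by (simp add: \<sigma>'_def lin_flow_inverse lin_flow_inverse')

lemma sigma'_h: assumes "h \<in> hR" shows "\<sigma>' h = \<sigma> h - (\<Sum>\<beta>\<in>M. \<beta> (\<sigma> h) *\<^sub>R H \<beta>)"
  using lin_flow_sum_K_pi2_h[OF finite_M M_root M_so sigma_hR[OF assms]] by (simp add: sigma'_eq k_def)

lemma sum_H_hR: "(\<Sum>\<beta>\<in>M. c \<beta> *\<^sub>R H \<beta>) \<in> hR"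
  using M_root H_hR by (intro subspace_sum[OF subspace_hR] subspace_scale[OF subspace_hR]) auto

lemma sigma'_in: "\<sigma>' \<in> Inv_tau br hR \<tau>"
proof (rule Inv_tauI)
  have "linear \<sigma>'"
    using linear_compose[OF linear_compose[OF linear_E linear_sigma] linear_E]
    by (simp add: o_def \<sigma>'_def[abs_def])
  moreover have "bij \<sigma>'" using sigma'_sigma' by (rule involuntory_imp_bij)
  moreover have "\<sigma>' (br x y) = br (\<sigma>' x) (\<sigma>' y)" for x y
    by (simp add: \<sigma>'_def lin_flow_br sigma_br)
  ultimately show "lie_aut br \<sigma>'" by (simp add: lie_aut_def)
  show "\<sigma>' h \<in> hR" if "h \<in> hR" for h
    using sigma'_h[OF that] subspace_diff[OF subspace_hR sigma_hR[OF that] sum_H_hR] by simp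
  show "\<sigma>' (\<tau> x) = \<tau> (\<sigma>' x)" for x by (simp add: sigma'_eq tau_E sigma_tau)
qed (rule sigma'_sigma')

text \<open>\<open>E (- (pi / 4))\<close> conjugates \<sigma>' back to \<sigma>; applied to both
  components it is a complex automorphism carrying one real form to the other.\<close>

lemma gfix_iso: "real_lie_iso br (gfix \<sigma>') (gfix \<sigma>)"
proof -
  let ?f = "map_prod (E (- (pi / 4))) (E (- (pi / 4)))"
  have "?f u \<in> gfix \<sigma>" if "u \<in> gfix \<sigma>'" for u
  proof -
    have "\<sigma> (E (- (pi / 4)) x) = E (- (pi / 4)) (\<sigma>' x)" for x
      by (simp add: \<sigma>'_def lin_flow_inverse')
    then show ?thesis using that by (simp add: gfix_def linear_neg[OF linear_E])
  qed
  moreover have "map_prod (E (pi / 4)) (E (pi / 4)) u \<in> gfix \<sigma>'" if "u \<in> gfix \<sigma>" for u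
    using that by (auto simp: gfix_def \<sigma>'_def lin_flow_inverse' linear_neg[OF linear_E])
  ultimately have "bij_betw ?f (gfix \<sigma>') (gfix \<sigma>)"
    by (intro bij_betw_byWitness[where f' = "map_prod (E (pi / 4)) (E (pi / 4))"])
      (auto simp: lin_flow_inverse lin_flow_inverse' map_prod_def split_beta)
  then show ?thesis
    unfolding real_lie_iso_def
    by (intro exI[of _ ?f])
      (simp add: map_prod_def split_beta cbr_def linear_add[OF linear_E] linear_diff[OF linear_E]
        linear_scale[OF linear_E] lin_flow_br)
qed

lemma imag_sigma': "imag_roots br hR (rho hR \<sigma>') = imag \<inter> orth_roots br hR M"
proof -
  have e: "\<alpha> (\<sigma>' h) = \<alpha> (\<sigma> h) - (\<Sum>\<beta>\<in>M. \<beta> (\<sigma> h) * \<alpha> (H \<beta>))" if a: "\<alpha> \<in> \<Phi>" and h: "h \<in> hR" for \<alpha> h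
  proof -
    have "\<alpha> (\<sigma>' h) = \<alpha> (\<sigma> h) - \<alpha> (\<Sum>\<beta>\<in>M. \<beta> (\<sigma> h) *\<^sub>R H \<beta>)"
      unfolding sigma'_h[OF h] by (rule dual_diff[OF root_dual[OF a] sigma_hR[OF h] sum_H_hR])
    also have "\<alpha> (\<Sum>\<beta>\<in>M. \<beta> (\<sigma> h) *\<^sub>R H \<beta>) = (\<Sum>\<beta>\<in>M. \<alpha> (\<beta> (\<sigma> h) *\<^sub>R H \<beta>))"
      using M_root H_hR by (intro dual_sum root_dual a subspace_scale[OF subspace_hR]) auto
    also have "\<dots> = (\<Sum>\<beta>\<in>M. \<beta> (\<sigma> h) * \<alpha> (H \<beta>))"
      using M_root H_hR by (intro sum.cong refl dual_scale root_dual a) auto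
    finally show ?thesis .
  qed
  have iff: "(\<forall>h\<in>hR. \<alpha> (\<sigma>' h) = - \<alpha> h) \<longleftrightarrow> (\<forall>h\<in>hR. \<alpha> (\<sigma> h) = - \<alpha> h) \<and> (\<forall>\<beta>\<in>M. \<alpha> (H \<beta>) = 0)"
    if a: "\<alpha> \<in> \<Phi>" for \<alpha>
  proof -
    \<comment> \<open>Test at \<open>h = H \<beta>\<close>, which \<sigma> negates. Only the term of
      \<beta> survives in the sum, so \<alpha> takes the same value at
      \<open>\<sigma>' (H \<beta>)\<close> as at \<open>H \<beta>\<close>. An imaginary root has to
      change sign there, so the value is \<open>0\<close>.\<close>
    have z: "\<alpha> (H \<beta>) = 0" if i: "\<forall>h\<in>hR. \<alpha> (\<sigma>' h) = - \<alpha> h" and b: "\<beta> \<in> M" for \<beta>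
    proof -
      have br: "\<beta> \<in> \<Phi>" and bn: "\<beta> \<in> nc" using b M_root M_sub by auto
      have s: "\<sigma> (H \<beta>) = - H \<beta>" by (rule sigma_H[OF bn])
      have "\<gamma> (\<sigma> (H \<beta>)) * \<alpha> (H \<gamma>) = (if \<gamma> = \<beta> then - 2 * \<alpha> (H \<beta>) else 0)" if g: "\<gamma> \<in> M" for \<gamma>
      proof -
        have gr: "\<gamma> \<in> \<Phi>" using g M_root by auto
        have "\<gamma> (\<sigma> (H \<beta>)) = - \<gamma> (H \<beta>)" unfolding s by (rule dual_neg[OF root_dual[OF gr] H_hR[OF br]])
        moreover have "\<gamma> \<noteq> \<beta> \<Longrightarrow> \<gamma> (H \<beta>) = 0"
          using strongly_orthD(1)[OF M_strongly_orth[OF g b]] ip_eq_0_iff[OF gr br] by simp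
        ultimately show ?thesis using root_H_self[OF br] by auto
      qed
      then have "(\<Sum>\<gamma>\<in>M. \<gamma> (\<sigma> (H \<beta>)) * \<alpha> (H \<gamma>)) = - 2 * \<alpha> (H \<beta>)"
        using b finite_M by (simp add: sum.delta cong: sum.cong)
      moreover have "\<alpha> (\<sigma> (H \<beta>)) = - \<alpha> (H \<beta>)"
        unfolding s by (rule dual_neg[OF root_dual[OF a] H_hR[OF br]])
      ultimately show ?thesis using e[OF a H_hR[OF br]] i H_hR[OF br] by simp
    qed
    have q: "\<alpha> (\<sigma>' h) = \<alpha> (\<sigma> h)" if "\<forall>\<beta>\<in>M. \<alpha> (H \<beta>) = 0" "h \<in> hR" for h
      using e[OF a that(2)] that(1) by simp
    show ?thesis
    proof
      assume i: "\<forall>h\<in>hR. \<alpha> (\<sigma>' h) = - \<alpha> h"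
      then have "\<forall>\<beta>\<in>M. \<alpha> (H \<beta>) = 0" using z by blast
      then show "(\<forall>h\<in>hR. \<alpha> (\<sigma> h) = - \<alpha> h) \<and> (\<forall>\<beta>\<in>M. \<alpha> (H \<beta>) = 0)" using q i by simp
    qed (use q in simp)
  qed
  show ?thesis
  proof (rule set_eqI)
    fix \<alpha>
    show "\<alpha> \<in> imag_roots br hR (rho hR \<sigma>') \<longleftrightarrow> \<alpha> \<in> imag \<inter> orth_roots br hR M"
    proof (cases "\<alpha> \<in> \<Phi>")
      case True
      have "(\<forall>\<beta>\<in>M. ip \<alpha> \<beta> = 0) \<longleftrightarrow> (\<forall>\<beta>\<in>M. \<alpha> (H \<beta>) = 0)"
        using ip_eq_0_iff[OF True] M_root by blast
      then show ?thesis
        using iff[OF True] True by (simp add: imag_roots_rho[of \<sigma>', OF sigma'_sigma'] imag_iff orth_roots_def)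
    qed (simp add: imag_roots_def)
  qed
qed

text \<open>In the noncompact case two different \<open>\<beta>, \<gamma> \<in> M\<close> cannot both have \<open>\<alpha> + \<beta>\<close> and \<open>\<alpha> + \<gamma>\<close> roots:
  the reflection in \<open>\<alpha> + \<gamma>\<close> would map \<open>\<alpha> + \<beta>\<close> to the root \<open>\<beta> - \<gamma>\<close>.\<close>
lemma sigma'_X:
  assumes a: "\<alpha> \<in> imag" and o: "\<And>\<beta>. \<beta> \<in> M \<Longrightarrow> ip \<alpha> \<beta> = 0"
  shows "\<sigma>' (X \<alpha>) = X (negf \<alpha>)"
proof -
  have ar: "\<alpha> \<in> \<Phi>" using a by (rule imag_root)
  have so: "strongly_orth br hR \<beta> \<alpha>" if b: "\<beta> \<in> M" and n: "addf \<alpha> \<beta> \<notin> \<Phi>" for \<beta>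
  proof -
    have br: "\<beta> \<in> \<Phi>" using b M_root by auto
    \<comment> \<open>If \<alpha> - \<beta> were a root, reflecting it in
      \<open>negf \<beta>\<close> would make \<alpha> + \<beta> one.\<close>
    have "addf \<alpha> (negf (negf \<beta>)) \<in> \<Phi>" if "addf \<alpha> (negf \<beta>) \<in> \<Phi>"
      using orth_diff_root[OF ar negf_root[OF br] _ that] o[OF b] ip_negf_right[OF ar br] by simp
    then have "addf \<alpha> (negf \<beta>) \<notin> \<Phi>" using n by auto
    moreover have "\<alpha> \<noteq> \<beta>" using o[OF b] ip_pos[OF br] by auto
    ultimately have "strongly_orth br hR \<alpha> \<beta>"
      using n o[OF b] by (simp add: strongly_orth_def addf_def)
    then show ?thesis using strongly_orth_commute ar br by blast
  qed
  have K0: "br (K \<beta>) (X \<alpha>) = 0" if "\<beta> \<in> M" "addf \<alpha> \<beta> \<notin> \<Phi>" for \<beta>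
    using br_K_X_strongly_orth(1)[OF _ ar so[OF that]] that(1) M_root by auto
  \<comment> \<open>Since \<tau> commutes with the flow, it suffices to follow
    \<open>X \<alpha>\<close> instead of \<open>X (negf \<alpha>)\<close>.\<close>
  have tE: "E (pi / 2) (X (negf \<alpha>)) = \<tau> (E (pi / 2) (X \<alpha>))" by (simp add: tau_E tau_X ar)
  show ?thesis
  proof (cases "\<sigma> (X \<alpha>) = X (negf \<alpha>)")
    case True
    have "br k (X \<alpha>) = 0"
      using K0 compact_orth_sum_not_root[OF a True o] by (simp add: k_def br_sum_left)
    then show ?thesis using True tE by (simp add: sigma'_eq lin_flow_fixed tau_X ar)
  next
    case False
    then have m: "\<sigma> (X \<alpha>) = - X (negf \<alpha>)" using sigma_X_imag[OF a] by blast
    then have an: "\<alpha> \<in> nc" using a by (simp add: nc_iff)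
    have "\<alpha> \<notin> M" using o ip_pos[OF ar] by force
    \<comment> \<open>Otherwise \<alpha> could be added to \<open>M\<close>, against
      maximality.\<close>
    have "\<exists>\<beta>\<in>M. addf \<alpha> \<beta> \<in> \<Phi>"
    proof (rule ccontr)
      assume "\<not> ?thesis"
      then have s: "strongly_orth br hR \<beta> \<alpha> \<and> strongly_orth br hR \<alpha> \<beta>" if "\<beta> \<in> M" for \<beta>
        using so[OF that] strongly_orth_commute[OF _ ar] that M_root by blast
      then have "pairwise_so br hR (insert \<alpha> M)" using M_so by (auto simp: pairwise_so_def)
      then have "insert \<alpha> M = M" using M_max an M_sub by blast
      then show False using \<open>\<alpha> \<notin> M\<close> by blast
    qed
    then obtain \<beta> where b: "\<beta> \<in> M" and p: "addf \<alpha> \<beta> \<in> \<Phi>" by blast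
    have br: "\<beta> \<in> \<Phi>" using b M_root by auto
    have nr: "addf \<alpha> \<gamma> \<notin> \<Phi>" if g: "\<gamma> \<in> M" "\<gamma> \<noteq> \<beta>" for \<gamma>
    proof
      let ?p = "addf \<alpha> \<beta>" and ?q = "addf \<alpha> \<gamma>"
      assume q: "?q \<in> \<Phi>"
      have gr: "\<gamma> \<in> \<Phi>" using g M_root by auto
      have sbg: "strongly_orth br hR \<beta> \<gamma>" using M_strongly_orth b g by auto
      have "ip ?q \<alpha> = ip \<alpha> \<alpha>" "ip ?q \<beta> = 0"
        using ip_addf[OF ar gr q ar] ip_addf[OF ar gr q br] o[OF g(1)] o[OF b] strongly_orthD(1)[OF sbg]
        by (simp_all add: ip_commute)
      then have "ip ?p ?q = ip \<alpha> \<alpha>"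
        using ip_addf[OF ar br p q] by (simp add: ip_commute[of \<alpha> ?q] ip_commute[of \<beta> ?q])
      \<comment> \<open>\<open>?q\<close> has twice the square length of \<alpha>, so the
        coefficient is \<open>1\<close> and the reflection subtracts \<open>?q\<close> exactly
        once.\<close>
      then have "?p (H ?q) = 1"
        using root_H[OF p q] orth_sum_root(2)[OF ar gr o[OF g(1)] q] ip_pos[OF ar] by simp
      then have "(\<lambda>x. ?p x - ?q x) \<in> \<Phi>" using reflection_root[OF p q] by simp
      moreover have "(\<lambda>x. ?p x - ?q x) = addf \<beta> (negf \<gamma>)" by (simp add: fun_eq_iff)
      ultimately show False using strongly_orthD(3)[OF sbg] by simp
    qed
    have kK: "br k v = br (K \<beta>) v + (\<Sum>\<gamma>\<in>M - {\<beta>}. br (K \<gamma>) v)" for v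
      unfolding k_def br_sum_left using finite_M b by (simp add: sum.remove)
    have kX: "br k (X \<alpha>) = br (K \<beta>) (X \<alpha>)"
      unfolding kK using K0 nr by simp
    \<comment> \<open>\<open>K \<gamma>\<close> commutes with \<open>K \<beta>\<close> and with
      \<open>X \<alpha>\<close>, hence with their bracket. So \<open>br k\<close> acts twice on
      \<open>X \<alpha>\<close> as \<open>br (K \<beta>)\<close> does.\<close>
    have "br (K \<gamma>) (br (K \<beta>) (X \<alpha>)) = 0" if "\<gamma> \<in> M - {\<beta>}" for \<gamma>
    proof -
      have "strongly_orth br hR \<gamma> \<beta>" using M_strongly_orth b that by auto
      then have "br (K \<gamma>) (X \<beta>) = 0" "br (K \<gamma>) (X (negf \<beta>)) = 0"
        using br_K_X_strongly_orth[of \<gamma> \<beta>] br that M_root by auto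
      then have "br (K \<gamma>) (K \<beta>) = 0" unfolding K_def[of \<beta>] br_add_right by simp
      moreover have "br (K \<gamma>) (X \<alpha>) = 0" using K0 nr that by auto
      ultimately show ?thesis using jacobi[of "K \<gamma>" "K \<beta>" "X \<alpha>"] by (simp add: br_linear)
    qed
    then have "br k (br k (X \<alpha>)) = - 4 *\<^sub>R X \<alpha>"
      unfolding kX unfolding kK br_K_twice[OF ar br o[OF b] p] by simp
    \<comment> \<open>This sign cancels the one in \<open>m\<close> and makes \<alpha>
      compact.\<close>
    then have "E (pi / 2) (X \<alpha>) = - X \<alpha>" by (rule lin_flow_rotation)
    then show ?thesis
      using m tE by (simp add: sigma'_eq linear_neg[OF linear_E] linear_neg[OF linear_tau] tau_X ar)
  qed
qed

end

theorem theorem4p12: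
  fixes br :: "'a::euclidean_space \<Rightarrow> 'a \<Rightarrow> 'a"
    and hR :: "'a set"
    and X H :: "('a \<Rightarrow> real) \<Rightarrow> 'a"
    and \<tau> \<sigma> :: "'a \<Rightarrow> 'a"
    and s :: "('a \<Rightarrow> real) \<Rightarrow> ('a \<Rightarrow> real)"
    and M :: "('a \<Rightarrow> real) set"
  assumes chev: "chevalley_setup br hR X H \<tau>"
    and s_in: "s \<in> inv_rootsys br hR"
    and sigma_in: "\<sigma> \<in> Inv_tau br hR \<tau>"
    and rho_s: "\<forall>v\<in>dualV hR. rho hR \<sigma> v = s v"
    and M_sub: "M \<subseteq> noncompact_imag br hR X \<sigma>"
    and M_so: "pairwise_so br hR M"
    and M_max: "\<forall>B. M \<subseteq> B \<and> B \<subseteq> noncompact_imag br hR X \<sigma> \<and> pairwise_so br hR B \<longrightarrow> B = M"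
    and M_long: "\<forall>B. B \<subseteq> noncompact_imag br hR X \<sigma> \<and> pairwise_so br hR B \<and>
                   (\<forall>C. B \<subseteq> C \<and> C \<subseteq> noncompact_imag br hR X \<sigma> \<and> pairwise_so br hR C \<longrightarrow> C = B)
                   \<longrightarrow> card (B \<inter> long_roots br hR) \<le> card (M \<inter> long_roots br hR)"
  shows "\<exists>\<sigma>'\<in>Inv_tau br hR \<tau>.
           real_lie_iso br (gfix \<sigma>') (gfix \<sigma>) \<and>
           compact_imag br hR X \<sigma>' = imag_roots br hR s \<inter> orth_roots br hR M \<and>
           noncompact_imag br hR X \<sigma>' = {}"
proof -
  interpret cayley br hR X H \<tau> \<sigma> M
    by unfold_locales (fact chev sigma_in M_sub M_so M_max M_long)+
  have s: "imag_roots br hR s = imag"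
    using rho_s root_dual by (auto simp: imag_roots_def)
  \<comment> \<open>By \<open>imag_sigma'\<close> such a root is imaginary for \<sigma> and
    orthogonal to \<open>M\<close>, which is what \<open>sigma'_X\<close> asks for.\<close>
  have fixed: "\<sigma>' (X \<alpha>) = X (negf \<alpha>)" if "\<alpha> \<in> imag_roots br hR (rho hR \<sigma>')" for \<alpha>
    using that sigma'_X unfolding imag_sigma' by (auto simp: orth_roots_def)
  have "compact_imag br hR X \<sigma>' = imag_roots br hR s \<inter> orth_roots br hR M"
    using fixed unfolding compact_imag_def s imag_sigma'[symmetric] by blast
  moreover have "\<sigma>' (X \<alpha>) \<noteq> - X (negf \<alpha>)" if a: "\<alpha> \<in> imag_roots br hR (rho hR \<sigma>')" for \<alpha>
  proof
    assume "\<sigma>' (X \<alpha>) = - X (negf \<alpha>)"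
    then have "2 *\<^sub>R X (negf \<alpha>) = 0" using fixed[OF a] by (simp add: scaleR_2 eq_neg_iff_add_eq_0)
    moreover have "negf \<alpha> \<in> \<Phi>" using a negf_root by (simp add: imag_roots_def)
    ultimately show False using X_nonzero by simp
  qed
  then have "noncompact_imag br hR X \<sigma>' = {}" by (auto simp: noncompact_imag_def)
  ultimately show ?thesis using sigma'_in gfix_iso by blast
qed

end
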